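(* There exist constants $c,C>0$ such that the following holds. Let $n\ge 6$, $d\ge1$, and let $\boldsymbol\sigma=(\sigma_1,\dots,\sigma_n)$ be positive noise levels satisfying $$\frac{\max_i\sigma_i^2}{\min_i\sigma_i^2}-1\le\frac14\sqrt{\frac{\log n}{d}}.$$ Let $\bar\Theta_\kappa=\{\boldsymbol\theta\in(\mathbb R^d)^n:\ \bar\kappa(\boldsymbol\theta,\boldsymbol\sigma)\ge\kappa\}$. If $\kappa<\frac18\max\{(\log n)^{1/2},(c\,d\log n)^{1/4}\}$, then $$\inf_{\hat\pi}\ \max_{\pi^*\in\mathfrak S_n}\ \sup_{\boldsymbol\theta\in\bar\Theta_\kappa}\mathbf P_{\boldsymbol\theta,\boldsymbol\sigma,\pi^*}(\hat\pi\ne\pi^* )>C,$$ where the infimum is over all estimators $\hat\pi$ (measurable functions of the data with values in $\mathfrak S_n$).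
   Context: Model: integers $n\ge2$, $d\ge1$. Unknown parameters: $\boldsymbol\theta=(\theta_1,\dots,\theta_n)$ with $\theta_i\in\mathbb R^d$, noise levels $\boldsymbol\sigma=(\sigma_1,\dots,\sigma_n)$ with $\sigma_i>0$, and a permutation $\pi^*\in\mathfrak S_n$ (the symmetric group on $\{1,\dots,n\}$). One observes $X_i=\theta_i+\sigma_i\xi_i$, $X_i^\#=\theta_{\pi^*(i)}+\sigma_i^\#\xi_i^\#$, $i=1,\dots,n$, where $\sigma_i^\#=\sigma_{\pi^*(i)}$ and $\xi_1,\dots,\xi_n,\xi_1^\#,\dots,\xi_n^\#$ are i.i.d. $\mathcal N(0,I_d)$. The law of the data is $\mathbf P_{\boldsymbol\theta,\boldsymbol\sigma,\pi^*}$. Relative separation distance: $\bar\kappa(\boldsymbol\theta,\boldsymbol\sigma)=\min_{i\ne j}\frac{\|\theta_i-\theta_j\|}{(\sigma_i^2+\sigma_j^2)^{1/2}}$. *)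

theory Defs
  imports "HOL-Probability.Probability"
begin

text \<open>Index set of the scalar observations: (b, i, k) with b = False for X_i, b = True for
  X^#_i, i < n the item index and k < d the coordinate.\<close>
definition obs_index :: "nat \<Rightarrow> nat \<Rightarrow> (bool \<times> nat \<times> nat) set" where
  "obs_index n d = UNIV \<times> {0..<n} \<times> {0..<d}"

definition data_space :: "nat \<Rightarrow> nat \<Rightarrow> ((bool \<times> nat \<times> nat) \<Rightarrow> real) measure" where
  "data_space n d = PiM (obs_index n d) (\<lambda>_. lborel)"

text \<open>Law P_{theta,sigma,pi}: independent Gaussian coordinates;
  X_i = theta_i + sigma_i xi_i, X^#_i = theta_{pi i} + sigma_{pi i} xi^#_i.
  theta i k is the k-th coordinate of theta_i.\<close>
definition data_law ::
  "nat \<Rightarrow> nat \<Rightarrow> (nat \<Rightarrow> nat \<Rightarrow> real) \<Rightarrow> (nat \<Rightarrow> real) \<Rightarrow> (nat \<Rightarrow> nat)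
     \<Rightarrow> ((bool \<times> nat \<times> nat) \<Rightarrow> real) measure" where
  "data_law n d \<theta> \<sigma> \<pi> = PiM (obs_index n d)
     (\<lambda>(b, i, k). if b then density lborel (normal_density (\<theta> (\<pi> i) k) (\<sigma> (\<pi> i)))
                  else density lborel (normal_density (\<theta> i k) (\<sigma> i)))"

definition theta_dist :: "nat \<Rightarrow> (nat \<Rightarrow> nat \<Rightarrow> real) \<Rightarrow> nat \<Rightarrow> nat \<Rightarrow> real" where
  "theta_dist d \<theta> i j = sqrt (\<Sum>k<d. (\<theta> i k - \<theta> j k)\<^sup>2)"

definition rel_sep :: "nat \<Rightarrow> nat \<Rightarrow> (nat \<Rightarrow> nat \<Rightarrow> real) \<Rightarrow> (nat \<Rightarrow> real) \<Rightarrow> real" where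
  "rel_sep n d \<theta> \<sigma> = Min {theta_dist d \<theta> i j / sqrt ((\<sigma> i)\<^sup>2 + (\<sigma> j)\<^sup>2) | i j. i < n \<and> j < n \<and> i \<noteq> j}"

definition estimators :: "nat \<Rightarrow> nat \<Rightarrow> (((bool \<times> nat \<times> nat) \<Rightarrow> real) \<Rightarrow> (nat \<Rightarrow> nat)) set" where
  "estimators n d = {est. est \<in> measurable (data_space n d) (count_space UNIV) \<and>
      (\<forall>\<omega>\<in>space (data_space n d). est \<omega> permutes {0..<n})}"

definition err_prob ::
  "nat \<Rightarrow> nat \<Rightarrow> (nat \<Rightarrow> nat \<Rightarrow> real) \<Rightarrow> (nat \<Rightarrow> real) \<Rightarrow> (nat \<Rightarrow> nat)
     \<Rightarrow> (((bool \<times> nat \<times> nat) \<Rightarrow> real) \<Rightarrow> (nat \<Rightarrow> nat)) \<Rightarrow> real" where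
  "err_prob n d \<theta> \<sigma> \<pi> est =
     measure (data_law n d \<theta> \<sigma> \<pi>) {\<omega> \<in> space (data_law n d \<theta> \<sigma> \<pi>). est \<omega> \<noteq> \<pi>}"

end

(* Group the items into the pairs {2p, 2p+1} and let every pair be swapped or not by an independent
   fair coin (Assouad's scheme). The two parameters of a pair are beta_p + v and beta_p - v, where the
   pair centres beta_p are far apart and |2 v| is the smallest distance allowed by the separation
   condition. Given the data, the posterior factors over the pairs, so an estimator succeeds with
   probability at most the product over p of (1/2) int max(f_p, g_p), where f_p and g_p are the
   densities of the data of pair p without and with swap; this is at most
   exp(-(sum over p of rho_p^2) / 4) with rho_p = int sqrt(f_p g_p). So rho_p^2 >= n^(-1/8) suffices.

   For d <= log n take v deterministic: Gaussian affinities are explicit. For d > log n take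
   v = a (e_1, ..., e_d) with uniform random signs: the distances stay deterministic, whereas each
   coordinate only contributes a factor 1 - O(a^4) to the affinity, because the first-order terms cancel.
   The assumption on the noise levels bounds the loss due to unequal variances in a pair. *)
theory Submission
  imports Defs
begin

subsection \<open>Finite products of Lebesgue measure\<close>

text \<open>Testing one swap against none cannot suffice: the affinity is only kept above n^(-1/16),
  and with affinities tending to 0 a single pair is decided with error tending to 0. Recovery fails
  because about n/2 pairs must be decided correctly at once. The scale (d log n)^(1/4) comes from
  the signs. For noise of order one, a deterministic direction loses an exponent of order d a^2 =
  |v|^2 in the affinity, so |v| may only reach sqrt(log n); random signs reduce the loss to order d
  a^4 = |v|^4 / d. The obstacle is that one sign is shared by both items of a pair and by both
  samples. The mixture is not a product over observations, and the smallest independent unit is one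
  coordinate of one pair. The affinity of two such mixtures has no closed form: once a common
  Gaussian factor is taken out, the square root of a product of hyperbolic cosines remains, and a
  polynomial inequality bounds it by explicit means. All constants are fitted to one budget: each
  coordinate may lose a factor exp(- log n / (16 d)).\<close>

lemma (in product_sigma_finite) product_nn_integral_group:
  assumes "finite J" "\<And>j. j \<in> J \<Longrightarrow> finite (B j)" "disjoint_family_on B J"
    and "\<And>j. j \<in> J \<Longrightarrow> F j \<in> borel_measurable (PiM (B j) M)"
  shows "(\<integral>\<^sup>+\<omega>. (\<Prod>j\<in>J. F j (restrict \<omega> (B j))) \<partial>PiM (\<Union>j\<in>J. B j) M)
    = (\<Prod>j\<in>J. integral\<^sup>N (PiM (B j) M) (F j))"
  using assms
proof (induction J rule: finite_induct)
  case empty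
  then show ?case by (simp add: PiM_empty)
next
  case (insert a J)
  let ?U = "\<Union>j\<in>J. B j"
  note F[measurable] = insert.prems(3)
  have dis: "B a \<inter> ?U = {}"
    using insert.prems(2) insert.hyps by (auto simp: disjoint_family_on_def)
  have fin: "finite (B a)" "finite ?U" using insert by auto
  have meas: "(\<lambda>\<omega>. F j (restrict \<omega> (B j))) \<in> borel_measurable (PiM V M)"
    if "j \<in> insert a J" "B j \<subseteq> V" for j V
    using that by (intro measurable_compose[OF measurable_restrict_subset F]) auto
  have "(\<integral>\<^sup>+\<omega>. (\<Prod>j\<in>insert a J. F j (restrict \<omega> (B j))) \<partial>PiM (\<Union>j\<in>insert a J. B j) M)
    = (\<integral>\<^sup>+\<omega>. F a (restrict \<omega> (B a)) * (\<Prod>j\<in>J. F j (restrict \<omega> (B j))) \<partial>PiM (B a \<union> ?U) M)"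
    using insert.hyps by simp
  also have "\<dots> = (\<integral>\<^sup>+x. (\<integral>\<^sup>+y. F a (restrict (merge (B a) ?U (x, y)) (B a)) *
      (\<Prod>j\<in>J. F j (restrict (merge (B a) ?U (x, y)) (B j))) \<partial>PiM ?U M) \<partial>PiM (B a) M)"
    by (intro product_nn_integral_fold dis fin borel_measurable_times_ennreal borel_measurable_prod_ennreal meas) auto
  \<comment> \<open>Since the blocks are disjoint, the factor of \<open>a\<close> depends on x alone
    and all others on y alone.\<close>
  also have "\<dots> = (\<integral>\<^sup>+x. (\<integral>\<^sup>+y. F a x * (\<Prod>j\<in>J. F j (restrict y (B j))) \<partial>PiM ?U M) \<partial>PiM (B a) M)"
  proof (intro nn_integral_cong)
    fix x y assume x: "x \<in> space (PiM (B a) M)" and "y \<in> space (PiM ?U M)"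
    have "restrict (merge (B a) ?U (x, y)) (B a) = x"
      using x by (auto simp: merge_def space_PiM PiE_iff extensional_def restrict_def fun_eq_iff)
    moreover have "restrict (merge (B a) ?U (x, y)) (B j) = restrict y (B j)" if "j \<in> J" for j
      using dis that by (fastforce simp: merge_def restrict_def fun_eq_iff)
    ultimately show "F a (restrict (merge (B a) ?U (x, y)) (B a)) *
      (\<Prod>j\<in>J. F j (restrict (merge (B a) ?U (x, y)) (B j))) = F a x * (\<Prod>j\<in>J. F j (restrict y (B j)))"
      by simp
  qed
  also have "\<dots> = (\<integral>\<^sup>+x. F a x * (\<integral>\<^sup>+y. (\<Prod>j\<in>J. F j (restrict y (B j))) \<partial>PiM ?U M) \<partial>PiM (B a) M)"
    by (intro nn_integral_cong nn_integral_cmult borel_measurable_prod_ennreal meas) auto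
  also have "\<dots> = integral\<^sup>N (PiM (B a) M) (F a) * (\<integral>\<^sup>+y. (\<Prod>j\<in>J. F j (restrict y (B j))) \<partial>PiM ?U M)"
    by (intro nn_integral_multc) auto
  also have "\<dots> = (\<Prod>j\<in>insert a J. integral\<^sup>N (PiM (B j) M) (F j))"
    using insert.hyps insert.prems by (subst insert.IH) (auto simp: disjoint_family_on_def)
  finally show ?case .
qed

interpretation lborel_PiM: product_sigma_finite "\<lambda>_. lborel :: real measure"
  by standard

text \<open>A common dominating measure is needed to add and compare likelihoods under different
  permutations. The normalization of each \<open>f i\<close> makes the factors probability measures,
  hence sigma-finite.\<close>

lemma PiM_density_lborel:
  fixes f :: "'i \<Rightarrow> real \<Rightarrow> ennreal"
  assumes I: "finite I"
    and f[measurable]: "\<And>i. i \<in> I \<Longrightarrow> f i \<in> borel_measurable borel"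
    and 1: "\<And>i. i \<in> I \<Longrightarrow> (\<integral>\<^sup>+x. f i x \<partial>lborel) = 1"
  shows "PiM I (\<lambda>i. density lborel (f i)) = density (PiM I (\<lambda>_. lborel)) (\<lambda>\<omega>. \<Prod>i\<in>I. f i (\<omega> i))"
proof -
  \<comment> \<open>The locale for product measures asks for a sigma-finite measure at every index,
    so \<open>f\<close> is extended outside \<open>I\<close> by one of its own members.\<close>
  define g where "g i = (if i \<in> I then f i else f (SOME i. i \<in> I))" for i
  show ?thesis
  proof (cases "I = {}")
    case True
    then show ?thesis by (auto intro!: measure_eqI simp: PiM_empty emeasure_density)
  next
    case False
    then have in_I: "(SOME i. i \<in> I) \<in> I" by (simp add: some_in_eq)
    have g[measurable]: "g i \<in> borel_measurable borel" for i
      using in_I f by (auto simp: g_def)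
    have ps: "prob_space (density lborel (g i))" for i
      using in_I 1 by (intro prob_spaceI) (auto simp: emeasure_density g_def)
    interpret P: product_sigma_finite "\<lambda>i. density lborel (g i)"
      by (intro product_sigma_finite.intro prob_space_imp_sigma_finite ps)
    have "PiM I (\<lambda>i. density lborel (g i)) = density (PiM I (\<lambda>_. lborel)) (\<lambda>\<omega>. \<Prod>i\<in>I. g i (\<omega> i))"
    proof (rule P.PiM_eqI[symmetric])
      show "finite I" by fact
      show "sets (density (PiM I (\<lambda>_. lborel)) (\<lambda>\<omega>. \<Prod>i\<in>I. g i (\<omega> i))) = sets (PiM I (\<lambda>i. density lborel (g i)))"
        unfolding sets_density by (rule sets_PiM_cong) auto
      fix A assume A: "\<And>i. i \<in> I \<Longrightarrow> A i \<in> sets (density lborel (g i))"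
      then have A'[measurable]: "\<And>i. i \<in> I \<Longrightarrow> A i \<in> sets borel" by simp
      have "emeasure (density (PiM I (\<lambda>_. lborel)) (\<lambda>\<omega>. \<Prod>i\<in>I. g i (\<omega> i))) (Pi\<^sub>E I A)
        = (\<integral>\<^sup>+\<omega>. (\<Prod>i\<in>I. g i (\<omega> i)) * indicator (Pi\<^sub>E I A) \<omega> \<partial>PiM I (\<lambda>_. lborel))"
        using I by (intro emeasure_density) (auto intro!: sets_PiM_I_finite)
      also have "\<dots> = (\<integral>\<^sup>+\<omega>. (\<Prod>i\<in>I. g i (\<omega> i) * indicator (A i) (\<omega> i)) \<partial>PiM I (\<lambda>_. lborel))"
      proof (intro nn_integral_cong)
        fix \<omega> assume "\<omega> \<in> space (PiM I (\<lambda>_. lborel :: real measure))"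
        then have "\<omega> \<in> extensional I" by (simp add: space_PiM PiE_iff)
        then have "indicator (Pi\<^sub>E I A) \<omega> = (\<Prod>i\<in>I. indicator (A i) (\<omega> i) :: ennreal)"
          using I by (cases "\<forall>i\<in>I. \<omega> i \<in> A i") (auto simp: indicator_def PiE_iff intro!: prod_zero[symmetric])
        then show "(\<Prod>i\<in>I. g i (\<omega> i)) * indicator (Pi\<^sub>E I A) \<omega> = (\<Prod>i\<in>I. g i (\<omega> i) * indicator (A i) (\<omega> i))"
          by (simp add: prod.distrib)
      qed
      also have "\<dots> = (\<Prod>i\<in>I. \<integral>\<^sup>+x. g i x * indicator (A i) x \<partial>lborel)"
        using I by (intro lborel_PiM.product_nn_integral_prod) auto
      also have "\<dots> = (\<Prod>i\<in>I. emeasure (density lborel (g i)) (A i))"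
        by (intro prod.cong) (auto simp: emeasure_density)
      finally show "emeasure (density (PiM I (\<lambda>_. lborel)) (\<lambda>\<omega>. \<Prod>i\<in>I. g i (\<omega> i))) (Pi\<^sub>E I A)
        = (\<Prod>i\<in>I. emeasure (density lborel (g i)) (A i))" .
    qed
    then show ?thesis
      by (simp add: g_def cong: PiM_cong prod.cong)
  qed
qed

subsection \<open>Affinities of Gaussian products\<close>

lemma nn_integral_normal_density:
  "v > 0 \<Longrightarrow> (\<integral>\<^sup>+x. ennreal (normal_density b v x) \<partial>lborel) = 1"
  by (subst nn_integral_eq_integral) auto

lemma nn_integral_normal_density_exp:
  assumes "v > 0"
  shows "(\<integral>\<^sup>+x. ennreal (normal_density b v x * exp (c * (x - b))) \<partial>lborel) = ennreal (exp (c\<^sup>2 * v\<^sup>2 / 2))"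
proof -
  have "normal_density b v x * exp (c * (x - b)) = exp (c\<^sup>2 * v\<^sup>2 / 2) * normal_density (b + c * v\<^sup>2) v x" for x
  proof -
    have "- (x - b)\<^sup>2 / (2 * v\<^sup>2) + c * (x - b) = c\<^sup>2 * v\<^sup>2 / 2 + - (x - (b + c * v\<^sup>2))\<^sup>2 / (2 * v\<^sup>2)"
      using assms by (simp add: field_simps power2_eq_square)
    then have "exp (- (x - b)\<^sup>2 / (2 * v\<^sup>2)) * exp (c * (x - b)) = exp (c\<^sup>2 * v\<^sup>2 / 2) * exp (- (x - (b + c * v\<^sup>2))\<^sup>2 / (2 * v\<^sup>2))"
      by (simp only: exp_add[symmetric])
    then show ?thesis by (simp add: normal_density_def)
  qed
  then show ?thesis
    using assms by (simp add: ennreal_mult nn_integral_cmult nn_integral_normal_density)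
qed

text \<open>The next bound replaces the square root by hyperbolic cosines,
  whose Gaussian means are explicit, without losing the terms of second order.\<close>
lemma sqrt_cosh_mult_ge:
  "sqrt (cosh x * cosh y) + (cosh (2 * x) + cosh (2 * y)) / 2 + 3 \<ge> 5/2 * (cosh x + cosh y)" for x y :: real
proof -
  define u v where "u = cosh x - 1" and "v = cosh y - 1"
  have uv: "u \<ge> 0" "v \<ge> 0" by (auto simp: u_def v_def cosh_real_ge_1)
  let ?r = "sqrt (cosh x * cosh y)"
  let ?s = "sqrt (1 + u + v)"
  have s0: "?s \<ge> 0" using uv by simp
  have "cosh x * cosh y = 1 + u + v + u * v" by (simp add: u_def v_def algebra_simps)
  then have "?r \<ge> ?s" using uv by simp
  \<comment> \<open>The polynomial is s^4 - 3 s^2 + 2 s. With w = s^2 it says sqrt w \<ge> (3 w -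
    w^2) / 2, a bound that is tangent at w = 1.\<close>
  have "?s * (?s - 1)\<^sup>2 * (?s + 2) \<ge> 0" using s0 by simp
  then have "2 * ?s \<ge> 3 * ?s ^ 2 - ?s ^ 4" by (simp add: algebra_simps power2_eq_square power4_eq_xxxx)
  also have "?s ^ 2 = 1 + u + v" using uv by simp
  also have "?s ^ 4 = (1 + u + v)\<^sup>2" using uv by (metis \<open>?s ^ 2 = 1 + u + v\<close> power_mult numeral_Bit0 mult_2)
  finally have "2 * ?s \<ge> 3 * (1 + u + v) - (1 + u + v)\<^sup>2" by simp
  moreover have "(1 + u + v)\<^sup>2 \<le> 1 + 2 * u + 2 * v + 2 * u\<^sup>2 + 2 * v\<^sup>2"
    using zero_le_power2[of "u - v"] by (simp add: algebra_simps power2_eq_square)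
  moreover have "cosh (2 * x) = 2 * (1 + u)\<^sup>2 - 1" "cosh (2 * y) = 2 * (1 + v)\<^sup>2 - 1"
    using cosh_double_cosh[of x] cosh_double_cosh[of y] by (auto simp: u_def v_def)
  moreover have "cosh x = 1 + u" "cosh y = 1 + v" by (auto simp: u_def v_def)
  moreover have "(1 + u)\<^sup>2 = 1 + 2 * u + u\<^sup>2" "(1 + v)\<^sup>2 = 1 + 2 * v + v\<^sup>2"
    by (simp_all add: power2_eq_square algebra_simps)
  ultimately show ?thesis
    using \<open>?r \<ge> ?s\<close> by argo
qed

text \<open>The geometric mean of two Gaussian densities is a multiple of a Gaussian one: precisions
  are averaged, which gives the harmonic mean of the variances and the precision-weighted mean. The
  factor in front is the Bhattacharyya coefficient.\<close>

lemma sqrt_normal_density_mult: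
  assumes "s > 0" "t > 0"
  shows "sqrt (normal_density m s x * normal_density l t x)
    = sqrt (2 * s * t / (s\<^sup>2 + t\<^sup>2)) * exp (- (m - l)\<^sup>2 / (4 * (s\<^sup>2 + t\<^sup>2)))
      * normal_density ((m * t\<^sup>2 + l * s\<^sup>2) / (s\<^sup>2 + t\<^sup>2)) (sqrt (2 * s\<^sup>2 * t\<^sup>2 / (s\<^sup>2 + t\<^sup>2))) x"
proof -
  have D: "s\<^sup>2 + t\<^sup>2 > 0" using assms by (simp add: add_pos_pos)
  let ?D = "s\<^sup>2 + t\<^sup>2" and ?\<mu> = "(m * t\<^sup>2 + l * s\<^sup>2) / (s\<^sup>2 + t\<^sup>2)"
  let ?e = "- (m - l)\<^sup>2 / (4 * ?D)" and ?v = "2 * s\<^sup>2 * t\<^sup>2 / ?D"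
  \<comment> \<open>Completing the square with free variables: \<open>C\<close> stands for the
    squared mean gap and \<open>Q / D\<^sup>2\<close> for the squared distance to the new
    mean.\<close>
  have identity: "- A / (2 * S) + - B / (2 * T) = 2 * (- C / (4 * D) + - (Q / D\<^sup>2) / (2 * (2 * S * T / D)))"
    if "D * (T * A + S * B) = S * T * C + Q" "S > 0" "T > 0" "D > 0" for A B C D S T Q :: real
  proof -
    have "- A / (2 * S) + - B / (2 * T) = - (D * (T * A + S * B)) / (2 * S * T * D)"
      using that(2-) by (simp add: field_simps)
    also have "\<dots> = 2 * (- C / (4 * D) + - (Q / D\<^sup>2) / (2 * (2 * S * T / D)))"
      using that(2-) unfolding that(1) by (simp add: field_simps power2_eq_square)
    finally show ?thesis .
  qed
  have e: "- (x - m)\<^sup>2 / (2 * s\<^sup>2) + - (x - l)\<^sup>2 / (2 * t\<^sup>2) = 2 * (?e + - (x - ?\<mu>)\<^sup>2 / (2 * ?v))"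
  proof -
    have "?D * (t\<^sup>2 * (x - m)\<^sup>2 + s\<^sup>2 * (x - l)\<^sup>2) = s\<^sup>2 * t\<^sup>2 * (m - l)\<^sup>2 + (?D * x - (m * t\<^sup>2 + l * s\<^sup>2))\<^sup>2"
      by (simp add: algebra_simps power2_eq_square)
    moreover have "(x - ?\<mu>)\<^sup>2 = (?D * x - (m * t\<^sup>2 + l * s\<^sup>2))\<^sup>2 / ?D\<^sup>2"
      using D by (simp only: power_divide[symmetric] diff_divide_distrib nonzero_mult_div_cancel_left less_imp_neq not_sym)
    ultimately show ?thesis
      using identity[OF _ _ _ D] assms by (metis zero_less_power)
  qed
  have c: "(1 / sqrt (2 * pi * s\<^sup>2)) * (1 / sqrt (2 * pi * t\<^sup>2)) = (sqrt (2 * s * t / ?D) * (1 / sqrt (2 * pi * ?v)))\<^sup>2"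
  proof -
    have "sqrt (2 * pi * s\<^sup>2) * sqrt (2 * pi * t\<^sup>2) = 2 * pi * s * t"
      using assms by (simp add: real_sqrt_mult algebra_simps flip: power2_eq_square)
    moreover have "(sqrt (2 * s * t / ?D) * (1 / sqrt (2 * pi * ?v)))\<^sup>2 = (2 * s * t / ?D) / (2 * pi * ?v)"
      using assms D by (simp add: power_mult_distrib power_divide)
    moreover have "(2 * s * t / ?D) / (2 * pi * ?v) = 1 / (2 * pi * s * t)"
      using assms D by (simp add: divide_simps power2_eq_square)
    ultimately show ?thesis by (metis mult_1 times_divide_times_eq)
  qed
  have v2: "(sqrt ?v)\<^sup>2 = ?v"
    using assms D by (intro real_sqrt_pow2) simp
  have "normal_density m s x * normal_density l t x
      = (1 / sqrt (2 * pi * s\<^sup>2)) * (1 / sqrt (2 * pi * t\<^sup>2)) * exp (- (x - m)\<^sup>2 / (2 * s\<^sup>2) + - (x - l)\<^sup>2 / (2 * t\<^sup>2))"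
    unfolding normal_density_def exp_add by simp
  also have "\<dots> = (sqrt (2 * s * t / ?D) * (1 / sqrt (2 * pi * ?v)))\<^sup>2 * (exp (?e + - (x - ?\<mu>)\<^sup>2 / (2 * ?v)))\<^sup>2"
    unfolding c e exp_double ..
  also have "\<dots> = (sqrt (2 * s * t / ?D) * exp ?e * normal_density ?\<mu> (sqrt ?v) x)\<^sup>2"
    using v2 by (simp only: normal_density_def exp_add power_mult_distrib mult_ac)
  finally show ?thesis
    using assms D by (simp add: real_sqrt_abs abs_mult abs_of_nonneg)
qed

text \<open>Half of the bounded integral is the success probability of the best test between
  \<open>f\<close> and \<open>g\<close> under equal weights. Pointwise \<rho> sqrt(f g) \<le> min +
  (\<rho>^2 / 4) max by the AM-GM inequality, and min + max = f + g. Integrating, with the integral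
  of the maximum at most 2, leaves 2 - \<rho>^2 / 2.\<close>

lemma nn_integral_max_le_Hellinger:
  fixes f g :: "'a \<Rightarrow> real"
  assumes [measurable]: "f \<in> borel_measurable M" "g \<in> borel_measurable M"
    and nonneg: "\<And>x. f x \<ge> 0" "\<And>x. g x \<ge> 0"
    and int: "(\<integral>\<^sup>+x. ennreal (f x) \<partial>M) = 1" "(\<integral>\<^sup>+x. ennreal (g x) \<partial>M) = 1"
    and \<rho>: "\<rho> \<ge> 0" "ennreal \<rho> \<le> (\<integral>\<^sup>+x. ennreal (sqrt (f x * g x)) \<partial>M)"
  shows "(\<integral>\<^sup>+x. ennreal (max (f x) (g x)) \<partial>M) \<le> ennreal (2 * exp (- (\<rho>\<^sup>2 / 4)))"
proof -
  let ?X = "\<integral>\<^sup>+x. ennreal (max (f x) (g x)) \<partial>M"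
  have "?X \<le> (\<integral>\<^sup>+x. ennreal (f x) + ennreal (g x) \<partial>M)"
    using nonneg by (intro nn_integral_mono) (auto simp flip: ennreal_plus intro!: ennreal_leI)
  also have "\<dots> = 2" by (simp add: nn_integral_add int)
  finally have X2: "?X \<le> 2" .
  then obtain x where x: "x \<ge> 0" "?X = ennreal x"
    by (cases ?X) (auto simp: top_unique)
  with X2 have x2: "x \<le> 2" by (simp flip: ennreal_numeral)
  have pw: "\<rho> * sqrt (a * b) + max a b \<le> a + b + \<rho>\<^sup>2 / 4 * max a b" if "a \<ge> 0" "b \<ge> 0" for a b :: real
  proof -
    have "sqrt (a * b) = sqrt (min a b) * sqrt (max a b)"
      by (auto simp: min_def max_def real_sqrt_mult)
    moreover have "min a b = (sqrt (min a b))\<^sup>2" "max a b = (sqrt (max a b))\<^sup>2"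
      using that by auto
    moreover have "(sqrt (min a b) - \<rho> / 2 * sqrt (max a b))\<^sup>2 \<ge> 0" by simp
    moreover have "a + b = min a b + max a b" by auto
    ultimately show ?thesis
      by (simp add: power2_eq_square algebra_simps)
  qed
  have "ennreal \<rho> * ennreal \<rho> + ?X \<le> ennreal \<rho> * (\<integral>\<^sup>+x. ennreal (sqrt (f x * g x)) \<partial>M) + ?X"
    using \<rho> by (intro add_right_mono mult_left_mono) auto
  also have "\<dots> = (\<integral>\<^sup>+x. ennreal \<rho> * ennreal (sqrt (f x * g x)) + ennreal (max (f x) (g x)) \<partial>M)"
    by (simp add: nn_integral_add nn_integral_cmult)
  also have "\<dots> \<le> (\<integral>\<^sup>+x. ennreal (f x) + ennreal (g x) + ennreal (\<rho>\<^sup>2 / 4) * ennreal (max (f x) (g x)) \<partial>M)"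
    using pw[OF nonneg] nonneg \<rho>
    by (intro nn_integral_mono) (auto simp: max.coboundedI1 simp flip: ennreal_plus ennreal_mult intro!: ennreal_leI)
  also have "\<dots> = 1 + 1 + ennreal (\<rho>\<^sup>2 / 4) * ?X"
    by (simp add: nn_integral_add nn_integral_cmult int)
  also have "\<dots> = ennreal (2 + \<rho>\<^sup>2 / 4 * x)"
    unfolding x(2) using x(1) by (subst ennreal_plus) (simp_all add: ennreal_mult del: times_divide_eq_left)
  also have "ennreal \<rho> * ennreal \<rho> + ?X = ennreal (\<rho> * \<rho> + x)"
    using \<rho> x by (simp add: ennreal_mult ennreal_plus)
  finally have "ennreal (\<rho> * \<rho> + x) \<le> ennreal (2 + \<rho>\<^sup>2 / 4 * x)" .
  then have "\<rho> * \<rho> + x \<le> 2 + \<rho>\<^sup>2 / 4 * x" using x by (subst (asm) ennreal_le_iff) auto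
  moreover have "\<rho>\<^sup>2 / 4 * x \<le> \<rho>\<^sup>2 / 4 * 2" using x2 by (intro mult_left_mono) auto
  ultimately have "x \<le> 2 * (1 - \<rho>\<^sup>2 / 4)" by (simp add: power2_eq_square)
  also have "\<dots> \<le> 2 * exp (- (\<rho>\<^sup>2 / 4))" using exp_ge_add_one_self[of "- (\<rho>\<^sup>2 / 4)"] by simp
  finally show ?thesis using x by (simp add: ennreal_leI)
qed

section \<open>Gaussian means of exponentials and hyperbolic cosines\<close>

lemma nn_integral_normal_prod_exp:
  fixes b c \<tau> :: "'i \<Rightarrow> real"
  assumes "finite J" "\<And>x. x \<in> J \<Longrightarrow> \<tau> x > 0"
  shows "(\<integral>\<^sup>+\<omega>. ennreal ((\<Prod>x\<in>J. normal_density (b x) (\<tau> x) (\<omega> x)) * exp (\<Sum>x\<in>J. c x * (\<omega> x - b x))) \<partial>PiM J (\<lambda>_. lborel))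
    = ennreal (exp ((\<Sum>x\<in>J. (c x)\<^sup>2 * (\<tau> x)\<^sup>2) / 2))"
proof -
  have "(\<integral>\<^sup>+\<omega>. ennreal ((\<Prod>x\<in>J. normal_density (b x) (\<tau> x) (\<omega> x)) * exp (\<Sum>x\<in>J. c x * (\<omega> x - b x))) \<partial>PiM J (\<lambda>_. lborel))
    = (\<integral>\<^sup>+\<omega>. (\<Prod>x\<in>J. ennreal (normal_density (b x) (\<tau> x) (\<omega> x) * exp (c x * (\<omega> x - b x)))) \<partial>PiM J (\<lambda>_. lborel))"
    using assms(1) by (intro nn_integral_cong) (simp add: exp_sum prod_ennreal prod.distrib)
  also have "\<dots> = (\<Prod>x\<in>J. \<integral>\<^sup>+y. ennreal (normal_density (b x) (\<tau> x) y * exp (c x * (y - b x))) \<partial>lborel)"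
    using assms(1) by (intro lborel_PiM.product_nn_integral_prod) auto
  also have "\<dots> = (\<Prod>x\<in>J. ennreal (exp ((c x)\<^sup>2 * (\<tau> x)\<^sup>2 / 2)))"
    using assms(2) by (intro prod.cong) (simp_all add: nn_integral_normal_density_exp)
  also have "\<dots> = ennreal (exp ((\<Sum>x\<in>J. (c x)\<^sup>2 * (\<tau> x)\<^sup>2) / 2))"
    using assms(1) by (simp add: prod_ennreal exp_sum sum_divide_distrib)
  finally show ?thesis .
qed

lemma measurable_normal_prod[measurable]:
  "finite J \<Longrightarrow> (\<lambda>\<omega>. \<Prod>x\<in>J. normal_density (b x) (\<tau> x) (\<omega> x)) \<in> borel_measurable (PiM J (\<lambda>_. lborel))"
  by measurable

lemma ennreal_half_add_half: "a \<ge> 0 \<Longrightarrow> ennreal (1/2) * ennreal a + ennreal (1/2) * ennreal a = ennreal a"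
  by (subst (1 2) ennreal_mult[symmetric], simp, simp, subst ennreal_plus[symmetric]) auto

text \<open>\<open>cosh\<close> averages two exponential tilts of opposite sign with equal means.
  The scale \<open>r\<close> is kept free because r = 0, 1 and 2 all occur; r = 0 gives the total
  mass of the Gaussian product.\<close>

lemma nn_integral_normal_prod_cosh:
  fixes b c \<tau> :: "'i \<Rightarrow> real"
  assumes "finite J" "\<And>x. x \<in> J \<Longrightarrow> \<tau> x > 0"
  shows "(\<integral>\<^sup>+\<omega>. ennreal ((\<Prod>x\<in>J. normal_density (b x) (\<tau> x) (\<omega> x)) * cosh (r * (\<Sum>x\<in>J. c x * (\<omega> x - b x)))) \<partial>PiM J (\<lambda>_. lborel))
    = ennreal (exp (r\<^sup>2 * (\<Sum>x\<in>J. (c x)\<^sup>2 * (\<tau> x)\<^sup>2) / 2))"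
proof -
  let ?\<Psi> = "\<lambda>\<omega>. \<Prod>x\<in>J. normal_density (b x) (\<tau> x) (\<omega> x)"
  let ?e = "\<lambda>q \<omega>. ?\<Psi> \<omega> * exp (\<Sum>x\<in>J. (q * c x) * (\<omega> x - b x))"
  have [measurable]: "?\<Psi> \<in> borel_measurable (PiM J (\<lambda>_. lborel))" by (rule measurable_normal_prod[OF assms(1)])
  have \<Psi>0: "?\<Psi> \<omega> \<ge> 0" for \<omega> by (intro prod_nonneg) simp
  have "(\<integral>\<^sup>+\<omega>. ennreal (?\<Psi> \<omega> * cosh (r * (\<Sum>x\<in>J. c x * (\<omega> x - b x)))) \<partial>PiM J (\<lambda>_. lborel))
     = (\<integral>\<^sup>+\<omega>. ennreal (1/2) * ennreal (?e r \<omega>) + ennreal (1/2) * ennreal (?e (- r) \<omega>) \<partial>PiM J (\<lambda>_. lborel))"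
  proof (rule nn_integral_cong)
    fix \<omega>
    have "?\<Psi> \<omega> * cosh (r * (\<Sum>x\<in>J. c x * (\<omega> x - b x))) = 1/2 * ?e r \<omega> + 1/2 * ?e (- r) \<omega>"
      by (simp add: cosh_field_def mult.assoc sum_negf flip: sum_distrib_left) (simp add: algebra_simps add_divide_distrib)
    then show "ennreal (?\<Psi> \<omega> * cosh (r * (\<Sum>x\<in>J. c x * (\<omega> x - b x))))
      = ennreal (1/2) * ennreal (?e r \<omega>) + ennreal (1/2) * ennreal (?e (- r) \<omega>)"
      using \<Psi>0[of \<omega>] by (simp only: ennreal_plus ennreal_mult mult_nonneg_nonneg exp_ge_zero zero_le_divide_1_iff zero_le_numeral)
  qed
  also have "\<dots> = ennreal (1/2) * ennreal (exp ((\<Sum>x\<in>J. (r * c x)\<^sup>2 * (\<tau> x)\<^sup>2) / 2))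
      + ennreal (1/2) * ennreal (exp ((\<Sum>x\<in>J. (- r * c x)\<^sup>2 * (\<tau> x)\<^sup>2) / 2))"
    by (subst nn_integral_add, measurable, subst (1 2) nn_integral_cmult, measurable)
       (simp only: nn_integral_normal_prod_exp[OF assms])
  also have "\<dots> = ennreal (exp (r\<^sup>2 * (\<Sum>x\<in>J. (c x)\<^sup>2 * (\<tau> x)\<^sup>2) / 2))"
    by (simp only: ennreal_half_add_half exp_ge_zero power_mult_distrib power2_minus mult.assoc sum_distrib_left)
  finally show ?thesis .
qed

lemma ennreal_diff_le_of_le_add: "ennreal (a - b) \<le> I" if "ennreal a \<le> I + ennreal b" "b \<ge> 0"
  using that by (cases I) (auto simp: ennreal_leI simp flip: ennreal_plus)

text \<open>Integrating \<open>sqrt_cosh_mult_ge\<close> against the Gaussian product uses only the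
  variance of each linear form, never their joint law; the common \<open>V\<close> makes the two
  contributions equal. The negative terms are kept on the other side, so that no integrals are
  subtracted.\<close>

lemma nn_integral_normal_prod_sqrt_cosh_ge:
  fixes b c c' \<tau> :: "'i \<Rightarrow> real"
  assumes J: "finite J" "\<And>x. x \<in> J \<Longrightarrow> \<tau> x > 0"
    and V: "(\<Sum>x\<in>J. (c x)\<^sup>2 * (\<tau> x)\<^sup>2) = V" "(\<Sum>x\<in>J. (c' x)\<^sup>2 * (\<tau> x)\<^sup>2) = V"
  shows "ennreal (5 * exp (V / 2) - (exp (2 * V) + 3))
    \<le> (\<integral>\<^sup>+\<omega>. ennreal ((\<Prod>x\<in>J. normal_density (b x) (\<tau> x) (\<omega> x))
        * sqrt (cosh (\<Sum>x\<in>J. c x * (\<omega> x - b x)) * cosh (\<Sum>x\<in>J. c' x * (\<omega> x - b x)))) \<partial>PiM J (\<lambda>_. lborel))"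
    (is "_ \<le> ?I")
proof (rule ennreal_diff_le_of_le_add)
  let ?M = "PiM J (\<lambda>_. lborel :: real measure)"
  let ?\<Psi> = "\<lambda>\<omega>. \<Prod>x\<in>J. normal_density (b x) (\<tau> x) (\<omega> x)"
  let ?z = "\<lambda>\<omega>. \<Sum>x\<in>J. c x * (\<omega> x - b x)" and ?y = "\<lambda>\<omega>. \<Sum>x\<in>J. c' x * (\<omega> x - b x)"
  have [measurable]: "?\<Psi> \<in> borel_measurable ?M" by (rule measurable_normal_prod[OF J(1)])
  have \<Psi>0: "?\<Psi> \<omega> \<ge> 0" for \<omega> by (intro prod_nonneg) simp
  have [measurable]: "(\<lambda>\<omega>. cosh (r * ?z \<omega>)) \<in> borel_measurable ?M" "(\<lambda>\<omega>. cosh (r * ?y \<omega>)) \<in> borel_measurable ?M" for r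
    unfolding cosh_field_def by measurable
  have [measurable]: "(\<lambda>\<omega>. cosh (?z \<omega>)) \<in> borel_measurable ?M" "(\<lambda>\<omega>. cosh (?y \<omega>)) \<in> borel_measurable ?M"
    unfolding cosh_field_def by measurable
  have cosh: "(\<integral>\<^sup>+\<omega>. ennreal (?\<Psi> \<omega> * cosh (r * ?z \<omega>)) \<partial>?M) = ennreal (exp (r\<^sup>2 * V / 2))"
    "(\<integral>\<^sup>+\<omega>. ennreal (?\<Psi> \<omega> * cosh (r * ?y \<omega>)) \<partial>?M) = ennreal (exp (r\<^sup>2 * V / 2))" for r
    using nn_integral_normal_prod_cosh[OF J, where b = b and r = r] V by auto
  have "ennreal (5 * exp (V / 2)) = ennreal (5/2) * (\<integral>\<^sup>+\<omega>. ennreal (?\<Psi> \<omega> * cosh (1 * ?z \<omega>)) \<partial>?M)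
      + ennreal (5/2) * (\<integral>\<^sup>+\<omega>. ennreal (?\<Psi> \<omega> * cosh (1 * ?y \<omega>)) \<partial>?M)"
    unfolding cosh by (simp flip: ennreal_plus ennreal_mult)
  also have "\<dots> = (\<integral>\<^sup>+\<omega>. ennreal (5/2) * ennreal (?\<Psi> \<omega> * cosh (1 * ?z \<omega>)) + ennreal (5/2) * ennreal (?\<Psi> \<omega> * cosh (1 * ?y \<omega>)) \<partial>?M)"
    by (subst nn_integral_add, measurable, subst (1 2) nn_integral_cmult, measurable)
  \<comment> \<open>The constant 3 is carried as a multiple of
    \<open>cosh (0 * ?z \<omega>)\<close>, so that one formula evaluates every term.\<close>
  also have "\<dots> \<le> (\<integral>\<^sup>+\<omega>. ennreal (?\<Psi> \<omega> * sqrt (cosh (?z \<omega>) * cosh (?y \<omega>)))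
      + (ennreal (1/2) * ennreal (?\<Psi> \<omega> * cosh (2 * ?z \<omega>)) + ennreal (1/2) * ennreal (?\<Psi> \<omega> * cosh (2 * ?y \<omega>))
      + ennreal 3 * ennreal (?\<Psi> \<omega> * cosh (0 * ?z \<omega>))) \<partial>?M)"
  proof (rule nn_integral_mono)
    fix \<omega>
    have "?\<Psi> \<omega> * (5/2 * (cosh (?z \<omega>) + cosh (?y \<omega>)))
      \<le> ?\<Psi> \<omega> * (sqrt (cosh (?z \<omega>) * cosh (?y \<omega>)) + (cosh (2 * ?z \<omega>) + cosh (2 * ?y \<omega>)) / 2 + 3)"
      by (intro mult_left_mono sqrt_cosh_mult_ge \<Psi>0)
    then have "5/2 * (?\<Psi> \<omega> * cosh (1 * ?z \<omega>)) + 5/2 * (?\<Psi> \<omega> * cosh (1 * ?y \<omega>))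
      \<le> ?\<Psi> \<omega> * sqrt (cosh (?z \<omega>) * cosh (?y \<omega>)) + (1/2 * (?\<Psi> \<omega> * cosh (2 * ?z \<omega>)) + 1/2 * (?\<Psi> \<omega> * cosh (2 * ?y \<omega>)) + 3 * (?\<Psi> \<omega> * cosh (0 * ?z \<omega>)))"
      by (simp add: algebra_simps add_divide_distrib)
    then have le: "ennreal (5/2 * (?\<Psi> \<omega> * cosh (1 * ?z \<omega>)) + 5/2 * (?\<Psi> \<omega> * cosh (1 * ?y \<omega>)))
      \<le> ennreal (?\<Psi> \<omega> * sqrt (cosh (?z \<omega>) * cosh (?y \<omega>)) + (1/2 * (?\<Psi> \<omega> * cosh (2 * ?z \<omega>)) + 1/2 * (?\<Psi> \<omega> * cosh (2 * ?y \<omega>)) + 3 * (?\<Psi> \<omega> * cosh (0 * ?z \<omega>))))"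
      by (rule ennreal_leI)
    have nn: "?\<Psi> \<omega> * cosh q \<ge> 0" "?\<Psi> \<omega> * sqrt (cosh p * cosh q) \<ge> 0" for p q :: real
      using \<Psi>0[of \<omega>] cosh_real_nonneg by auto
    show "ennreal (5/2) * ennreal (?\<Psi> \<omega> * cosh (1 * ?z \<omega>)) + ennreal (5/2) * ennreal (?\<Psi> \<omega> * cosh (1 * ?y \<omega>))
      \<le> ennreal (?\<Psi> \<omega> * sqrt (cosh (?z \<omega>) * cosh (?y \<omega>)))
      + (ennreal (1/2) * ennreal (?\<Psi> \<omega> * cosh (2 * ?z \<omega>)) + ennreal (1/2) * ennreal (?\<Psi> \<omega> * cosh (2 * ?y \<omega>))
      + ennreal 3 * ennreal (?\<Psi> \<omega> * cosh (0 * ?z \<omega>)))"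
      using le nn
      by (simp only: ennreal_plus ennreal_mult add_nonneg_nonneg mult_nonneg_nonneg divide_nonneg_nonneg
          zero_le_numeral zero_le_divide_1_iff)
  qed
  also have "\<dots> = ?I + (ennreal (1/2) * ennreal (exp (2\<^sup>2 * V / 2)) + ennreal (1/2) * ennreal (exp (2\<^sup>2 * V / 2)) + ennreal 3 * ennreal (exp (0\<^sup>2 * V / 2)))"
    by (subst nn_integral_add, measurable, subst nn_integral_add, measurable, subst nn_integral_add, measurable,
        subst (1 2 3) nn_integral_cmult, measurable) (simp only: cosh)
  also have "\<dots> = ?I + ennreal (exp (2 * V) + 3)"
    by (simp only: ennreal_half_add_half exp_ge_zero) simp
  finally show "ennreal (5 * exp (V / 2)) \<le> ?I + ennreal (exp (2 * V) + 3)" .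
qed (simp add: add_nonneg_nonneg)

lemma normal_density_shift:
  assumes "s > 0"
  shows "normal_density (b + a) s x = normal_density b s x * exp (- (a\<^sup>2 / (2 * s\<^sup>2))) * exp (a / s\<^sup>2 * (x - b))"
proof -
  have "- (x - (b + a))\<^sup>2 / (2 * s\<^sup>2) = - (x - b)\<^sup>2 / (2 * s\<^sup>2) + - (a\<^sup>2 / (2 * s\<^sup>2)) + a / s\<^sup>2 * (x - b)"
    using assms by (simp add: field_simps power2_eq_square)
  then show ?thesis
    unfolding normal_density_def by (simp only: exp_add mult.assoc)
qed

text \<open>The sign \<open>e\<close> is common to all coordinates of \<open>J\<close>. It leaves
  the quadratic part of the exponent unchanged and flips the linear part, so averaging yields one
  \<open>cosh\<close> of the whole sum, not a product over \<open>J\<close>.\<close>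

lemma prod_normal_density_symmetrized:
  fixes J :: "'i set"
  assumes "finite J" "\<And>x. x \<in> J \<Longrightarrow> s x > 0"
  shows "(\<Sum>e\<in>{1,-1}. \<Prod>x\<in>J. normal_density (b x + e * a x) (s x) (\<omega> x)) / 2
    = (\<Prod>x\<in>J. normal_density (b x) (s x) (\<omega> x)) * exp (- (\<Sum>x\<in>J. (a x)\<^sup>2 / (2 * (s x)\<^sup>2)))
      * cosh (\<Sum>x\<in>J. a x / (s x)\<^sup>2 * (\<omega> x - b x))"
proof -
  have "(\<Prod>x\<in>J. normal_density (b x + e * a x) (s x) (\<omega> x))
    = (\<Prod>x\<in>J. normal_density (b x) (s x) (\<omega> x)) * exp (- (\<Sum>x\<in>J. (a x)\<^sup>2 / (2 * (s x)\<^sup>2)))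
      * exp (e * (\<Sum>x\<in>J. a x / (s x)\<^sup>2 * (\<omega> x - b x)))" if "e \<in> {1, -1}" for e
  proof -
    have "(e * a x)\<^sup>2 = (a x)\<^sup>2" for x using that by auto
    then have "(\<Prod>x\<in>J. normal_density (b x + e * a x) (s x) (\<omega> x))
      = (\<Prod>x\<in>J. normal_density (b x) (s x) (\<omega> x) * exp (- ((a x)\<^sup>2 / (2 * (s x)\<^sup>2))) * exp (e * (a x / (s x)\<^sup>2 * (\<omega> x - b x))))"
      using assms by (intro prod.cong) (simp_all add: normal_density_shift)
    then show ?thesis
      using assms by (simp add: prod.distrib exp_sum sum_negf[symmetric] sum_distrib_left)
  qed
  then show ?thesis
    by (simp add: cosh_field_def field_simps)
qed

lemma sqrt_prod: "sqrt (\<Prod>x\<in>J. f x) = (\<Prod>x\<in>J. sqrt (f x))"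
  by (induction J rule: infinite_finite_induct) (auto simp: real_sqrt_mult)

lemma affinity_normal_prod:
  fixes J :: "'i set"
  assumes J: "finite J" "\<And>x. x \<in> J \<Longrightarrow> s x > 0" "\<And>x. x \<in> J \<Longrightarrow> t x > 0"
  shows "(\<integral>\<^sup>+\<omega>. ennreal (sqrt ((\<Prod>x\<in>J. normal_density (m x) (s x) (\<omega> x)) * (\<Prod>x\<in>J. normal_density (l x) (t x) (\<omega> x))))
      \<partial>PiM J (\<lambda>_. lborel))
    = ennreal (\<Prod>x\<in>J. sqrt (2 * s x * t x / ((s x)\<^sup>2 + (t x)\<^sup>2)) * exp (- (m x - l x)\<^sup>2 / (4 * ((s x)\<^sup>2 + (t x)\<^sup>2))))"
    (is "_ = ennreal (\<Prod>x\<in>J. ?A x)")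
proof -
  have "(\<integral>\<^sup>+y. ennreal (sqrt (normal_density (m x) (s x) y * normal_density (l x) (t x) y)) \<partial>lborel) = ennreal (?A x)"
    if "x \<in> J" for x
  proof -
    have pos: "s x > 0" "t x > 0" using J that by auto
    have "sqrt (2 * (s x)\<^sup>2 * (t x)\<^sup>2 / ((s x)\<^sup>2 + (t x)\<^sup>2)) > 0"
      using pos by (simp add: add_pos_pos)
    moreover have "?A x \<ge> 0" using pos by (auto intro!: mult_nonneg_nonneg divide_nonneg_nonneg)
    ultimately show ?thesis
      unfolding sqrt_normal_density_mult[OF pos]
      by (subst ennreal_mult) (simp_all add: nn_integral_cmult nn_integral_normal_density del: real_sqrt_gt_0_iff)
  qed
  moreover have "?A x \<ge> 0" if "x \<in> J" for x
    using J that by (intro mult_nonneg_nonneg) (auto intro!: mult_nonneg_nonneg divide_nonneg_nonneg dest: less_imp_le)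
  ultimately have "(\<Prod>x\<in>J. \<integral>\<^sup>+y. ennreal (sqrt (normal_density (m x) (s x) y * normal_density (l x) (t x) y)) \<partial>lborel) = ennreal (\<Prod>x\<in>J. ?A x)"
    by (simp add: prod_ennreal)
  moreover have "(\<integral>\<^sup>+\<omega>. ennreal (sqrt ((\<Prod>x\<in>J. normal_density (m x) (s x) (\<omega> x)) * (\<Prod>x\<in>J. normal_density (l x) (t x) (\<omega> x))))
      \<partial>PiM J (\<lambda>_. lborel))
    = (\<integral>\<^sup>+\<omega>. (\<Prod>x\<in>J. ennreal (sqrt (normal_density (m x) (s x) (\<omega> x) * normal_density (l x) (t x) (\<omega> x)))) \<partial>PiM J (\<lambda>_. lborel))"
    by (simp add: prod_ennreal sqrt_prod flip: prod.distrib)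
  moreover have "\<dots> = (\<Prod>x\<in>J. \<integral>\<^sup>+y. ennreal (sqrt (normal_density (m x) (s x) y * normal_density (l x) (t x) y)) \<partial>lborel)"
    using J(1) by (intro lborel_PiM.product_nn_integral_prod) auto
  ultimately show ?thesis by simp
qed

text \<open>Both mixtures have the same centre \<open>b\<close>, so the geometric mean of their
  Gaussian parts loses only variance factors and no mean gap; the offsets survive in the two
  \<open>cosh\<close> terms and in exp(- E). Equal \<open>E\<close> and \<open>V\<close> on both
  sides hold in the application because a swap only permutes the contributions.\<close>

lemma affinity_symmetrized_normal_prod_ge:
  fixes J :: "'i set"
  assumes J: "finite J" "\<And>x. x \<in> J \<Longrightarrow> s x > 0" "\<And>x. x \<in> J \<Longrightarrow> t x > 0"
    and \<tau>: "\<And>x. x \<in> J \<Longrightarrow> (\<tau> x)\<^sup>2 = 2 * (s x)\<^sup>2 * (t x)\<^sup>2 / ((s x)\<^sup>2 + (t x)\<^sup>2)"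
    and V: "(\<Sum>x\<in>J. (a x / (s x)\<^sup>2)\<^sup>2 * (\<tau> x)\<^sup>2) = V" "(\<Sum>x\<in>J. (a' x / (t x)\<^sup>2)\<^sup>2 * (\<tau> x)\<^sup>2) = V"
    and E: "(\<Sum>x\<in>J. (a x)\<^sup>2 / (2 * (s x)\<^sup>2)) = E" "(\<Sum>x\<in>J. (a' x)\<^sup>2 / (2 * (t x)\<^sup>2)) = E"
  shows "ennreal ((\<Prod>x\<in>J. sqrt (2 * s x * t x / ((s x)\<^sup>2 + (t x)\<^sup>2))) * exp (- E) * (5 * exp (V / 2) - (exp (2 * V) + 3)))
    \<le> (\<integral>\<^sup>+\<omega>. ennreal (sqrt ((\<Sum>e\<in>{1,-1}. \<Prod>x\<in>J. normal_density (b x + e * a x) (s x) (\<omega> x)) / 2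
        * ((\<Sum>e\<in>{1,-1}. \<Prod>x\<in>J. normal_density (b x + e * a' x) (t x) (\<omega> x)) / 2))) \<partial>PiM J (\<lambda>_. lborel))"
proof -
  \<comment> \<open>\<open>\<tau>\<close> is constrained only through its square; the positive root
    is needed as a standard deviation.\<close>
  define \<upsilon> where "\<upsilon> x = sqrt (2 * (s x)\<^sup>2 * (t x)\<^sup>2 / ((s x)\<^sup>2 + (t x)\<^sup>2))" for x
  have \<upsilon>: "\<upsilon> x > 0" "(\<upsilon> x)\<^sup>2 = (\<tau> x)\<^sup>2" if "x \<in> J" for x
    using J(2)[OF that] J(3)[OF that] \<tau>[OF that] by (auto simp: \<upsilon>_def add_pos_pos)
  define Z where "Z = (\<Prod>x\<in>J. sqrt (2 * s x * t x / ((s x)\<^sup>2 + (t x)\<^sup>2)))"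
  have Z0: "Z \<ge> 0"
    unfolding Z_def using J(2,3) by (intro prod_nonneg) (auto intro!: mult_nonneg_nonneg divide_nonneg_nonneg dest: less_imp_le)
  let ?\<Psi> = "\<lambda>\<omega>. \<Prod>x\<in>J. normal_density (b x) (\<upsilon> x) (\<omega> x)"
  let ?z = "\<lambda>\<omega>. \<Sum>x\<in>J. a x / (s x)\<^sup>2 * (\<omega> x - b x)" and ?y = "\<lambda>\<omega>. \<Sum>x\<in>J. a' x / (t x)\<^sup>2 * (\<omega> x - b x)"
  let ?M = "PiM J (\<lambda>_. lborel :: real measure)"
  have eq: "sqrt ((\<Sum>e\<in>{1,-1}. \<Prod>x\<in>J. normal_density (b x + e * a x) (s x) (\<omega> x)) / 2
        * ((\<Sum>e\<in>{1,-1}. \<Prod>x\<in>J. normal_density (b x + e * a' x) (t x) (\<omega> x)) / 2))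
     = Z * exp (- E) * (?\<Psi> \<omega> * sqrt (cosh (?z \<omega>) * cosh (?y \<omega>)))" for \<omega>
  proof -
    have b: "(b x * (t x)\<^sup>2 + b x * (s x)\<^sup>2) / ((s x)\<^sup>2 + (t x)\<^sup>2) = b x" if "x \<in> J" for x
    proof -
      have "(s x)\<^sup>2 + (t x)\<^sup>2 \<noteq> 0" using J(2)[OF that] by (simp add: sum_power2_eq_zero_iff)
      then show ?thesis by (simp add: field_simps)
    qed
    have "sqrt (normal_density (b x) (s x) (\<omega> x) * normal_density (b x) (t x) (\<omega> x))
      = sqrt (2 * s x * t x / ((s x)\<^sup>2 + (t x)\<^sup>2)) * normal_density (b x) (\<upsilon> x) (\<omega> x)" if "x \<in> J" for x
      by (simp add: sqrt_normal_density_mult[OF J(2)[OF that] J(3)[OF that]] b[OF that] \<upsilon>_def)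
    then have "sqrt ((\<Prod>x\<in>J. normal_density (b x) (s x) (\<omega> x)) * (\<Prod>x\<in>J. normal_density (b x) (t x) (\<omega> x))) = Z * ?\<Psi> \<omega>"
      unfolding Z_def by (simp add: sqrt_prod flip: prod.distrib)
    moreover have "sqrt (A * exp (- E) * C * (B * exp (- E) * D)) = sqrt (A * B) * exp (- E) * sqrt (C * D)" for A B C D
      by (simp add: real_sqrt_mult algebra_simps)
    ultimately show ?thesis
      by (subst (1 2) prod_normal_density_symmetrized) (simp_all only: J E mult.assoc, simp_all only: mult.left_commute)
  qed
  have [measurable]: "?\<Psi> \<in> borel_measurable ?M" by (rule measurable_normal_prod[OF J(1)])
  have [measurable]: "(\<lambda>\<omega>. cosh (?z \<omega>)) \<in> borel_measurable ?M" "(\<lambda>\<omega>. cosh (?y \<omega>)) \<in> borel_measurable ?M"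
    unfolding cosh_field_def by measurable
  have V': "(\<Sum>x\<in>J. (a x / (s x)\<^sup>2)\<^sup>2 * (\<upsilon> x)\<^sup>2) = V" "(\<Sum>x\<in>J. (a' x / (t x)\<^sup>2)\<^sup>2 * (\<upsilon> x)\<^sup>2) = V"
    using V \<upsilon>(2) by auto
  have "ennreal (Z * exp (- E) * (5 * exp (V / 2) - (exp (2 * V) + 3)))
     = ennreal (Z * exp (- E)) * ennreal (5 * exp (V / 2) - (exp (2 * V) + 3))"
    using Z0 by (intro ennreal_mult') simp
  also have "\<dots> \<le> ennreal (Z * exp (- E)) * (\<integral>\<^sup>+\<omega>. ennreal (?\<Psi> \<omega> * sqrt (cosh (?z \<omega>) * cosh (?y \<omega>))) \<partial>?M)"
    by (intro mult_left_mono nn_integral_normal_prod_sqrt_cosh_ge J(1) \<upsilon> V') auto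
  also have "\<dots> = (\<integral>\<^sup>+\<omega>. ennreal (Z * exp (- E) * (?\<Psi> \<omega> * sqrt (cosh (?z \<omega>) * cosh (?y \<omega>)))) \<partial>?M)"
    by (subst nn_integral_cmult[symmetric], measurable) (simp only: ennreal_mult' Z0 mult_nonneg_nonneg exp_ge_zero)
  finally show ?thesis
    unfolding eq Z_def[symmetric] .
qed

text \<open>At E = V / 2 the product is 5 - exp(3 V / 2) - 3 exp(- V / 2), whose first-order terms
  cancel; this is the gain of the random signs. Quadratic bounds on both exponentials leave 1 - 3
  V^2, which is at least exp(- 6 V^2) for such small \<open>V\<close>.\<close>

lemma affinity_constant_ge:
  fixes V E :: real
  assumes "E \<ge> 0" "2 * E \<le> V" "V \<le> 1/10"
  shows "exp (- E) * (5 * exp (V / 2) - (exp (2 * V) + 3)) \<ge> exp (- 6 * V\<^sup>2)"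
proof -
  have V0: "V \<ge> 0" using assms by simp
  have b1: "exp (3 * V / 2) \<le> 1 + 3 * V / 2 + (3 * V / 2)\<^sup>2"
    using assms V0 by (intro exp_bound) auto
  have b2: "exp (- (V / 2)) \<le> 1 - V / 2 + (V / 2)\<^sup>2"
  proof -
    have "exp (V / 2) \<ge> 1 + V / 2" by simp
    then have "exp (- (V / 2)) \<le> 1 / (1 + V / 2)" using V0 by (simp add: exp_minus field_simps)
    also have "\<dots> \<le> 1 - V / 2 + (V / 2)\<^sup>2"
      using V0 by (simp add: field_simps power2_eq_square)
    finally show ?thesis .
  qed
  have "exp (- 6 * V\<^sup>2) \<le> 1 - 3 * V\<^sup>2"
  proof -
    have V2: "V\<^sup>2 \<le> (1/10)\<^sup>2" using assms V0 by (intro power_mono) auto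
    have "1 + 6 * V\<^sup>2 \<le> exp (6 * V\<^sup>2)" by simp
    then have "inverse (exp (6 * V\<^sup>2)) \<le> inverse (1 + 6 * V\<^sup>2)"
      by (intro le_imp_inverse_le) (auto intro: add_pos_nonneg)
    then have "exp (- 6 * V\<^sup>2) \<le> 1 / (1 + 6 * V\<^sup>2)" by (simp add: exp_minus inverse_eq_divide)
    also have "\<dots> \<le> 1 - 3 * V\<^sup>2"
    proof -
      have "(1 - 3 * V\<^sup>2) * (1 + 6 * V\<^sup>2) = 1 + 3 * V\<^sup>2 * (1 - 6 * V\<^sup>2)" by (simp add: algebra_simps)
      moreover have "3 * V\<^sup>2 * (1 - 6 * V\<^sup>2) \<ge> 0" using V2 by (intro mult_nonneg_nonneg) (auto simp: power2_eq_square)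
      ultimately show ?thesis by (subst pos_divide_le_eq) (auto intro: add_pos_nonneg)
    qed
    finally show ?thesis .
  qed
  also have "1 - 3 * V\<^sup>2 \<le> 5 - exp (3 * V / 2) - 3 * exp (- (V / 2))"
    using b1 b2 by (simp add: power2_eq_square field_simps)
  also have "\<dots> = exp (- (V / 2)) * (5 * exp (V / 2) - (exp (2 * V) + 3))"
  proof -
    have "exp (- (V / 2)) * exp (V / 2) = 1" "exp (- (V / 2)) * exp (2 * V) = exp (3 * V / 2)"
      by (simp_all flip: exp_add)
    then show ?thesis by (simp add: algebra_simps)
  qed
  finally have *: "exp (- 6 * V\<^sup>2) \<le> exp (- (V / 2)) * (5 * exp (V / 2) - (exp (2 * V) + 3))" .
  moreover have "exp (- 6 * V\<^sup>2) > 0" by simp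
  \<comment> \<open>Passing from exp(- V / 2) to the larger exp(- E) requires a nonnegative bracket,
    which the bound just obtained provides.\<close>
  ultimately have "5 * exp (V / 2) - (exp (2 * V) + 3) > 0"
    by (metis exp_gt_zero less_le_trans zero_less_mult_pos)
  then have "exp (- (V / 2)) * (5 * exp (V / 2) - (exp (2 * V) + 3)) \<le> exp (- E) * (5 * exp (V / 2) - (exp (2 * V) + 3))"
    using assms by (intro mult_right_mono) auto
  with * show ?thesis by simp
qed

subsection \<open>The pairwise swap prior\<close>

definition partner :: "nat \<Rightarrow> nat" where
  "partner i = (if even i then i + 1 else i - 1)"

text \<open>\<open>W\<close> is the set of swapped pairs and ranges over subsets of
  \<open>{..<n div 2}\<close>. For odd n the last item has pair index \<open>n div 2\<close>,
  outside every such \<open>W\<close>, and stays fixed.\<close>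

definition swap_pairs :: "nat set \<Rightarrow> nat \<Rightarrow> nat" where
  "swap_pairs W i = (if i div 2 \<in> W then partner i else i)"

lemma partner_div_2 [simp]: "partner i div 2 = i div 2"
  by (auto simp: partner_def elim!: oddE)

lemma partner_partner [simp]: "partner (partner i) = i"
  by (auto simp: partner_def elim!: oddE)

lemma partner_less: "i div 2 < n div 2 \<Longrightarrow> partner i < n"
  by (auto simp: partner_def)

lemma swap_pairs_div_2 [simp]: "swap_pairs W i div 2 = i div 2"
  by (simp add: swap_pairs_def)

lemma swap_pairs_less: "W \<subseteq> {..<n div 2} \<Longrightarrow> i < n \<Longrightarrow> swap_pairs W i < n"
  using partner_less[of i n] by (auto simp: swap_pairs_def)

lemma swap_pairs_permutes:
  assumes "W \<subseteq> {..<n div 2}"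
  shows "swap_pairs W permutes {0..<n}"
proof (rule bij_imp_permutes)
  have inv: "swap_pairs W (swap_pairs W i) = i" for i
    by (simp add: swap_pairs_def)
  show "bij_betw (swap_pairs W) {0..<n} {0..<n}"
    using assms by (intro bij_betwI[where g = "swap_pairs W"]) (auto simp: inv swap_pairs_less)
  show "swap_pairs W i = i" if "i \<notin> {0..<n}" for i
  proof -
    have "n div 2 \<le> i div 2" using that by (simp add: div_le_mono)
    then show ?thesis using assms by (auto simp: swap_pairs_def)
  qed
qed

lemma swap_pairs_inj: "swap_pairs W = swap_pairs W' \<Longrightarrow> W = W'"
proof -
  assume "swap_pairs W = swap_pairs W'"
  then have "swap_pairs W (2 * p) = swap_pairs W' (2 * p)" for p by simp
  then have "p \<in> W \<longleftrightarrow> p \<in> W'" for p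
    by (fastforce simp: swap_pairs_def partner_def split: if_splits)
  then show ?thesis by blast
qed

lemma prob_space_data_law:
  assumes "\<And>i. i < n \<Longrightarrow> \<sigma> i > 0" and \<pi>: "\<pi> permutes {0..<n}"
  shows "prob_space (data_law n d \<theta> \<sigma> \<pi>)"
proof -
  have "\<pi> i < n" if "i < n" for i using permutes_in_image[OF \<pi>, of i] that by simp
  then show ?thesis
    unfolding data_law_def using assms(1)
    by (intro prob_space_PiM) (auto simp: obs_index_def split: prod.splits intro!: prob_space_normal_density)
qed

text \<open>\<open>\<beta> p\<close> is the value of every coordinate of the centre of pair
  \<open>p\<close>, \<open>a p\<close> the offset in each coordinate, and \<open>T\<close> the
  support of its uniform sign. Taking \<open>T\<close> to be {1} or {1, -1} lets the deterministic
  and the random direction share one development.\<close>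

locale paired_prior =
  fixes n d :: nat and \<sigma> \<beta> a :: "nat \<Rightarrow> real" and T :: "real set"
  assumes \<sigma>_pos: "i < n \<Longrightarrow> \<sigma> i > 0"
    and T: "finite T" "T \<noteq> {}"
begin

text \<open>The split of the data that stays independent after averaging over the signs: a sign
  belongs to a pair and a coordinate and is shared by up to four observations. The block with
  \<open>p = n div 2\<close> holds the unpaired last item if n is odd and is empty if n is
  even.\<close>

definition block :: "nat \<Rightarrow> nat \<Rightarrow> (bool \<times> nat \<times> nat) set" where
  "block p k = UNIV \<times> {i. i < n \<and> i div 2 = p} \<times> {k}"

definition pair_block :: "nat \<Rightarrow> (bool \<times> nat \<times> nat) set" where
  "pair_block p = (\<Union>k<d. block p k)"

text \<open>The item whose parameter generates the observation, with \<open>w\<close> telling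
  whether the pair is swapped; only the second sample reacts to a swap.\<close>

definition item :: "bool \<Rightarrow> bool \<times> nat \<times> nat \<Rightarrow> nat" where
  "item w x = (if fst x \<and> w then partner (fst (snd x)) else fst (snd x))"

definition offset :: "bool \<Rightarrow> bool \<times> nat \<times> nat \<Rightarrow> real" where
  "offset w x = (if even (item w x) then 1 else - 1) * a (item w x div 2)"

definition coord_lik :: "nat \<Rightarrow> nat \<Rightarrow> bool \<Rightarrow> real \<Rightarrow> (bool \<times> nat \<times> nat \<Rightarrow> real) \<Rightarrow> real" where
  "coord_lik p k w e \<omega> = (\<Prod>x\<in>block p k. normal_density (\<beta> p + e * offset w x) (\<sigma> (item w x)) (\<omega> x))"

definition coord_mix :: "nat \<Rightarrow> nat \<Rightarrow> bool \<Rightarrow> (bool \<times> nat \<times> nat \<Rightarrow> real) \<Rightarrow> real" where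
  "coord_mix p k w \<omega> = (\<Sum>e\<in>T. coord_lik p k w e \<omega>) / real (card T)"

definition pair_mix :: "nat \<Rightarrow> bool \<Rightarrow> (bool \<times> nat \<times> nat \<Rightarrow> real) \<Rightarrow> real" where
  "pair_mix p w \<omega> = (\<Prod>k<d. coord_mix p k w \<omega>)"

definition theta :: "(nat \<times> nat \<Rightarrow> real) \<Rightarrow> nat \<Rightarrow> nat \<Rightarrow> real" where
  "theta \<epsilon> i k = \<beta> (i div 2) + \<epsilon> (i div 2, k) * ((if even i then 1 else - 1) * a (i div 2))"

text \<open>The index range includes \<open>n div 2\<close>, so that the unpaired block is treated
  like the others and likelihoods are products over \<open>p \<le> n div 2\<close>.\<close>

definition prior_signs :: "(nat \<times> nat \<Rightarrow> real) set" where
  "prior_signs = PiE ({..n div 2} \<times> {..<d}) (\<lambda>_. T)"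

lemma card_T: "card T > 0" using T by (simp add: card_gt_0_iff)

lemma finite_block [simp]: "finite (block p k)" by (auto simp: block_def)

lemma finite_pair_block [simp]: "finite (pair_block p)" by (auto simp: pair_block_def)

lemma obs_index_eq: "obs_index n d = (\<Union>p\<le>n div 2. pair_block p)"
  by (auto simp: obs_index_def pair_block_def block_def intro: div_le_mono)

lemma disjoint_blocks: "disjoint_family_on (block p) {..<d}"
  by (auto simp: disjoint_family_on_def block_def)

lemma disjoint_pair_blocks: "disjoint_family_on pair_block {..n div 2}"
  by (auto simp: disjoint_family_on_def block_def pair_block_def)

lemma prod_obs_index:
  "(\<Prod>x\<in>obs_index n d. u x) = (\<Prod>p\<le>n div 2. \<Prod>k<d. \<Prod>x\<in>block p k. u x)" for u :: "_ \<Rightarrow> real"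
proof -
  have "(\<Prod>x\<in>obs_index n d. u x) = (\<Prod>p\<le>n div 2. \<Prod>x\<in>pair_block p. u x)"
    unfolding obs_index_eq using disjoint_pair_blocks
    by (intro prod.UNION_disjoint) (auto simp: disjoint_family_on_def)
  also have "\<dots> = (\<Prod>p\<le>n div 2. \<Prod>k<d. \<Prod>x\<in>block p k. u x)"
    unfolding pair_block_def using disjoint_blocks
    by (intro prod.cong refl prod.UNION_disjoint) (auto simp: disjoint_family_on_def)
  finally show ?thesis by simp
qed

text \<open>The proviso on \<open>w\<close> recurs below: a swap is considered only in a complete
  pair, since the partner in the unpaired block would be the index n, about whose noise level
  nothing is assumed.\<close>

lemma item_pos: "x \<in> block p k \<Longrightarrow> (w \<Longrightarrow> p < n div 2) \<Longrightarrow> \<sigma> (item w x) > 0"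
  by (auto simp: block_def item_def intro!: \<sigma>_pos partner_less)

lemma coord_lik_nonneg: "coord_lik p k w e \<omega> \<ge> 0"
  unfolding coord_lik_def by (intro prod_nonneg) simp

lemma coord_mix_nonneg: "coord_mix p k w \<omega> \<ge> 0"
  unfolding coord_mix_def by (intro divide_nonneg_nonneg sum_nonneg coord_lik_nonneg) simp

lemma pair_mix_nonneg: "pair_mix p w \<omega> \<ge> 0"
  unfolding pair_mix_def by (intro prod_nonneg coord_mix_nonneg ballI)

lemma coord_mix_restrict: "block p k \<subseteq> V \<Longrightarrow> coord_mix p k w (restrict \<omega> V) = coord_mix p k w \<omega>"
  unfolding coord_mix_def coord_lik_def
  by (intro arg_cong2[where f = "(/)"] sum.cong prod.cong) auto

lemma pair_mix_restrict: "pair_block p \<subseteq> V \<Longrightarrow> pair_mix p w (restrict \<omega> V) = pair_mix p w \<omega>"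
  unfolding pair_mix_def by (intro prod.cong refl coord_mix_restrict) (auto simp: pair_block_def)

lemma measurable_coord_lik: "block p k \<subseteq> V \<Longrightarrow> coord_lik p k w e \<in> borel_measurable (PiM V (\<lambda>_. lborel))"
  unfolding coord_lik_def
  by (intro borel_measurable_prod measurable_compose[OF measurable_component_singleton]) auto

lemma measurable_coord_mix: "block p k \<subseteq> V \<Longrightarrow> coord_mix p k w \<in> borel_measurable (PiM V (\<lambda>_. lborel))"
  unfolding coord_mix_def by (intro borel_measurable_divide borel_measurable_sum measurable_coord_lik) auto

lemma measurable_pair_mix: "pair_block p \<subseteq> V \<Longrightarrow> pair_mix p w \<in> borel_measurable (PiM V (\<lambda>_. lborel))"
  unfolding pair_mix_def by (intro borel_measurable_prod measurable_coord_mix) (auto simp: pair_block_def)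

lemma nn_integral_coord_lik:
  assumes "w \<Longrightarrow> p < n div 2"
  shows "(\<integral>\<^sup>+\<omega>. ennreal (coord_lik p k w e \<omega>) \<partial>PiM (block p k) (\<lambda>_. lborel)) = 1"
proof -
  have "(\<integral>\<^sup>+\<omega>. ennreal (coord_lik p k w e \<omega>) \<partial>PiM (block p k) (\<lambda>_. lborel))
    = (\<integral>\<^sup>+\<omega>. (\<Prod>x\<in>block p k. ennreal (normal_density (\<beta> p + e * offset w x) (\<sigma> (item w x)) (\<omega> x))) \<partial>PiM (block p k) (\<lambda>_. lborel))"
    by (simp add: coord_lik_def prod_ennreal)
  also have "\<dots> = (\<Prod>x\<in>block p k. \<integral>\<^sup>+y. ennreal (normal_density (\<beta> p + e * offset w x) (\<sigma> (item w x)) y) \<partial>lborel)"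
    by (intro lborel_PiM.product_nn_integral_prod) auto
  also have "\<dots> = 1"
    using item_pos assms by (intro prod.neutral ballI nn_integral_normal_density) auto
  finally show ?thesis .
qed

lemma nn_integral_coord_mix:
  assumes "w \<Longrightarrow> p < n div 2"
  shows "(\<integral>\<^sup>+\<omega>. ennreal (coord_mix p k w \<omega>) \<partial>PiM (block p k) (\<lambda>_. lborel)) = 1"
proof -
  have [measurable]: "coord_lik p k w e \<in> borel_measurable (PiM (block p k) (\<lambda>_. lborel))" for e
    by (rule measurable_coord_lik) simp
  have "(\<integral>\<^sup>+\<omega>. ennreal (coord_mix p k w \<omega>) \<partial>PiM (block p k) (\<lambda>_. lborel))
    = (\<integral>\<^sup>+\<omega>. ennreal (1 / card T) * (\<Sum>e\<in>T. ennreal (coord_lik p k w e \<omega>)) \<partial>PiM (block p k) (\<lambda>_. lborel))"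
    unfolding coord_mix_def
    by (intro nn_integral_cong) (simp add: sum_ennreal coord_lik_nonneg sum_nonneg flip: ennreal_mult)
  also have "\<dots> = ennreal (1 / card T) * (\<Sum>e\<in>T. 1)"
    using assms by (subst nn_integral_cmult, measurable, subst nn_integral_sum, measurable)
      (simp only: nn_integral_coord_lik)
  also have "\<dots> = ennreal (1 / card T) * ennreal (card T)"
    by (simp add: ennreal_of_nat_eq_real_of_nat)
  also have "\<dots> = 1"
    using card_T by (subst ennreal_mult[symmetric]) auto
  finally show ?thesis .
qed

text \<open>Independence of the coordinates within a pair, used to reduce both total masses and
  affinities to single blocks.\<close>

lemma nn_integral_pair_prod:
  fixes F :: "nat \<Rightarrow> (bool \<times> nat \<times> nat \<Rightarrow> real) \<Rightarrow> ennreal"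
  assumes "\<And>k. k < d \<Longrightarrow> F k \<in> borel_measurable (PiM (block p k) (\<lambda>_. lborel))"
    "\<And>k \<omega>. k < d \<Longrightarrow> F k (restrict \<omega> (block p k)) = F k \<omega>"
  shows "(\<integral>\<^sup>+\<omega>. (\<Prod>k<d. F k \<omega>) \<partial>PiM (pair_block p) (\<lambda>_. lborel))
    = (\<Prod>k<d. \<integral>\<^sup>+\<omega>. F k \<omega> \<partial>PiM (block p k) (\<lambda>_. lborel))"
proof -
  have "(\<integral>\<^sup>+\<omega>. (\<Prod>k<d. F k \<omega>) \<partial>PiM (pair_block p) (\<lambda>_. lborel))
    = (\<integral>\<^sup>+\<omega>. (\<Prod>k<d. F k (restrict \<omega> (block p k))) \<partial>PiM (pair_block p) (\<lambda>_. lborel))"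
    using assms(2) by simp
  also have "\<dots> = (\<Prod>k<d. \<integral>\<^sup>+\<omega>. F k \<omega> \<partial>PiM (block p k) (\<lambda>_. lborel))"
    unfolding pair_block_def using assms(1)
    by (intro lborel_PiM.product_nn_integral_group[where F = F and B = "block p"] disjoint_blocks) auto
  finally show ?thesis .
qed

lemma nn_integral_pair_mix:
  assumes "w \<Longrightarrow> p < n div 2"
  shows "(\<integral>\<^sup>+\<omega>. ennreal (pair_mix p w \<omega>) \<partial>PiM (pair_block p) (\<lambda>_. lborel)) = 1"
  using assms
  by (simp add: pair_mix_def coord_mix_nonneg nn_integral_pair_prod measurable_coord_mix coord_mix_restrict
      nn_integral_coord_mix flip: prod_ennreal)

lemma nn_integral_sqrt_pair_mix:
  "(\<integral>\<^sup>+\<omega>. ennreal (sqrt (pair_mix p w \<omega> * pair_mix p w' \<omega>)) \<partial>PiM (pair_block p) (\<lambda>_. lborel))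
    = (\<Prod>k<d. \<integral>\<^sup>+\<omega>. ennreal (sqrt (coord_mix p k w \<omega> * coord_mix p k w' \<omega>)) \<partial>PiM (block p k) (\<lambda>_. lborel))"
proof -
  have "(\<integral>\<^sup>+\<omega>. ennreal (sqrt (pair_mix p w \<omega> * pair_mix p w' \<omega>)) \<partial>PiM (pair_block p) (\<lambda>_. lborel))
    = (\<integral>\<^sup>+\<omega>. (\<Prod>k<d. ennreal (sqrt (coord_mix p k w \<omega> * coord_mix p k w' \<omega>))) \<partial>PiM (pair_block p) (\<lambda>_. lborel))"
    by (simp add: pair_mix_def sqrt_prod prod_ennreal coord_mix_nonneg flip: prod.distrib)
  also have "\<dots> = (\<Prod>k<d. \<integral>\<^sup>+\<omega>. ennreal (sqrt (coord_mix p k w \<omega> * coord_mix p k w' \<omega>)) \<partial>PiM (block p k) (\<lambda>_. lborel))"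
  proof (rule nn_integral_pair_prod)
    fix k
    have [measurable]: "coord_mix p k v \<in> borel_measurable (PiM (block p k) (\<lambda>_. lborel))" for v
      by (rule measurable_coord_mix) simp
    show "(\<lambda>\<omega>. ennreal (sqrt (coord_mix p k w \<omega> * coord_mix p k w' \<omega>))) \<in> borel_measurable (PiM (block p k) (\<lambda>_. lborel))"
      by measurable
  qed (simp add: coord_mix_restrict)
  finally show ?thesis .
qed

text \<open>Affinities multiply over the \<open>d\<close> independent coordinates, so
  \<open>g ^ d\<close> bounds the affinity of the pair and takes the place of \<rho> in the testing
  bound.\<close>

lemma nn_integral_max_pair_mix_le:
  assumes "p < n div 2" "g \<ge> 0"
    and g: "\<And>k. k < d \<Longrightarrow> ennreal g \<le> (\<integral>\<^sup>+\<omega>. ennreal (sqrt (coord_mix p k False \<omega> * coord_mix p k True \<omega>)) \<partial>PiM (block p k) (\<lambda>_. lborel))"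
  shows "(\<integral>\<^sup>+\<omega>. ennreal (max (pair_mix p False \<omega>) (pair_mix p True \<omega>)) \<partial>PiM (pair_block p) (\<lambda>_. lborel))
    \<le> ennreal (2 * exp (- ((g ^ d)\<^sup>2 / 4)))"
proof (rule nn_integral_max_le_Hellinger)
  have "ennreal (g ^ d) = (\<Prod>k<d. ennreal g)" using assms by (simp add: ennreal_power)
  also have "\<dots> \<le> (\<integral>\<^sup>+\<omega>. ennreal (sqrt (pair_mix p False \<omega> * pair_mix p True \<omega>)) \<partial>PiM (pair_block p) (\<lambda>_. lborel))"
    unfolding nn_integral_sqrt_pair_mix using g by (intro prod_mono_ennreal) auto
  finally show "ennreal (g ^ d) \<le> (\<integral>\<^sup>+\<omega>. ennreal (sqrt (pair_mix p False \<omega> * pair_mix p True \<omega>)) \<partial>PiM (pair_block p) (\<lambda>_. lborel))" .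
qed (use assms in \<open>auto simp: pair_mix_nonneg nn_integral_pair_mix measurable_pair_mix\<close>)

section \<open>Likelihoods of the whole data and the Bayes success probability\<close>

definition cell_lik :: "nat set \<Rightarrow> (nat \<times> nat \<Rightarrow> real) \<Rightarrow> (bool \<times> nat \<times> nat \<Rightarrow> real) \<Rightarrow> real" where
  "cell_lik W \<epsilon> \<omega> = (\<Prod>p\<le>n div 2. \<Prod>k<d. coord_lik p k (p \<in> W) (\<epsilon> (p, k)) \<omega>)"

lemma data_law_eq_density:
  assumes W: "W \<subseteq> {..<n div 2}"
  shows "data_law n d (theta \<epsilon>) \<sigma> (swap_pairs W)
    = density (PiM (obs_index n d) (\<lambda>_. lborel)) (\<lambda>\<omega>. ennreal (cell_lik W \<epsilon> \<omega>))"
proof -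
  define m where "m x = (case x of (b, i, k) \<Rightarrow> theta \<epsilon> (if b then swap_pairs W i else i) k)" for x :: "bool \<times> nat \<times> nat"
  define s where "s x = (case x of (b, i, k) \<Rightarrow> \<sigma> (if b then swap_pairs W i else i))" for x :: "bool \<times> nat \<times> nat"
  have fin: "finite (obs_index n d)" by (auto simp: obs_index_def)
  have s: "s x > 0" if "x \<in> obs_index n d" for x
    using that \<sigma>_pos swap_pairs_less[OF W] by (auto simp: s_def obs_index_def)
  \<comment> \<open>This ties the permutation to the blocks: inside pair \<open>p\<close> the law
    depends on \<open>W\<close> only through whether \<open>p \<in> W\<close>.\<close>
  have ms: "m x = \<beta> p + \<epsilon> (p, k) * offset (p \<in> W) x" "s x = \<sigma> (item (p \<in> W) x)" if "x \<in> block p k" for x p k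
    using that by (auto simp: block_def m_def s_def theta_def offset_def item_def swap_pairs_def)
  have "data_law n d (theta \<epsilon>) \<sigma> (swap_pairs W) = PiM (obs_index n d) (\<lambda>x. density lborel (\<lambda>y. ennreal (normal_density (m x) (s x) y)))"
    unfolding data_law_def by (intro PiM_cong) (auto simp: m_def s_def)
  also have "\<dots> = density (PiM (obs_index n d) (\<lambda>_. lborel)) (\<lambda>\<omega>. \<Prod>x\<in>obs_index n d. ennreal (normal_density (m x) (s x) (\<omega> x)))"
    using fin s by (intro PiM_density_lborel) (auto simp: nn_integral_normal_density)
  also have "(\<lambda>\<omega>. \<Prod>x\<in>obs_index n d. ennreal (normal_density (m x) (s x) (\<omega> x))) = (\<lambda>\<omega>. ennreal (cell_lik W \<epsilon> \<omega>))"
    by (simp add: fun_eq_iff prod_ennreal prod_obs_index cell_lik_def coord_lik_def ms cong: prod.cong)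
  finally show ?thesis .
qed

lemma finite_prior_signs: "finite prior_signs" and prior_signs_nonempty: "prior_signs \<noteq> {}"
  unfolding prior_signs_def using T by (auto intro!: finite_PiE simp: PiE_eq_empty_iff)

lemma card_prior_signs: "card prior_signs > 0"
  using finite_prior_signs prior_signs_nonempty by (simp add: card_gt_0_iff)

text \<open>Distributivity expresses the independence of the signs: a sum of products over all sign
  arrays is a product of sums over \<open>T\<close>, which leaves one mixture per pair and
  coordinate.\<close>

lemma sum_cell_lik:
  "(\<Sum>\<epsilon>\<in>prior_signs. cell_lik W \<epsilon> \<omega>) = real (card prior_signs) * (\<Prod>p\<le>n div 2. pair_mix p (p \<in> W) \<omega>)"
proof -
  let ?I = "{..n div 2} \<times> {..<d}"
  have "(\<Sum>\<epsilon>\<in>prior_signs. cell_lik W \<epsilon> \<omega>)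
    = (\<Sum>\<epsilon>\<in>PiE ?I (\<lambda>_. T). \<Prod>q\<in>?I. coord_lik (fst q) (snd q) (fst q \<in> W) (\<epsilon> q) \<omega>)"
    unfolding prior_signs_def cell_lik_def by (simp add: prod.cartesian_product case_prod_beta)
  also have "\<dots> = (\<Prod>q\<in>?I. \<Sum>e\<in>T. coord_lik (fst q) (snd q) (fst q \<in> W) e \<omega>)"
    using T by (subst prod_sum_PiE) auto
  also have "\<dots> = (\<Prod>q\<in>?I. real (card T) * coord_mix (fst q) (snd q) (fst q \<in> W) \<omega>)"
    using card_T by (simp add: coord_mix_def)
  also have "\<dots> = real (card T) ^ card ?I * (\<Prod>p\<le>n div 2. pair_mix p (p \<in> W) \<omega>)"
    by (simp add: prod.distrib pair_mix_def prod.cartesian_product case_prod_beta)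
  also have "real (card T) ^ card ?I = real (card prior_signs)"
    unfolding prior_signs_def by (subst card_PiE) auto
  finally show ?thesis .
qed

text \<open>Average over uniform \<open>W\<close> and uniform signs: given the data, at most one \<open>W\<close> is reported,
  so its likelihood may be replaced by the maximum over all \<open>W\<close>, which factors over the pairs.\<close>
lemma bayes_success_le:
  assumes est: "est \<in> estimators n d" and g: "g \<ge> 0"
    and aff: "\<And>p k. p < n div 2 \<Longrightarrow> k < d \<Longrightarrow> ennreal g
      \<le> (\<integral>\<^sup>+\<omega>. ennreal (sqrt (coord_mix p k False \<omega> * coord_mix p k True \<omega>)) \<partial>PiM (block p k) (\<lambda>_. lborel))"
    and err: "\<And>W \<epsilon>. W \<subseteq> {..<n div 2} \<Longrightarrow> \<epsilon> \<in> prior_signs \<Longrightarrow> err_prob n d (theta \<epsilon>) \<sigma> (swap_pairs W) est \<le> \<eta>"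
  shows "1 - \<eta> \<le> exp (- ((g ^ d)\<^sup>2 / 4)) ^ (n div 2)"
proof -
  let ?M = "n div 2" and ?L = "PiM (obs_index n d) (\<lambda>_. lborel :: real measure)"
  let ?r = "exp (- ((g ^ d)\<^sup>2 / 4))"
  let ?S = "real (card prior_signs)"
  let ?A = "\<lambda>W. {\<omega> \<in> space ?L. est \<omega> = swap_pairs W}"
  have pb: "pair_block p \<subseteq> obs_index n d" if "p \<le> ?M" for p
    using that unfolding obs_index_eq by auto
  have [measurable]: "est \<in> measurable ?L (count_space UNIV)"
    using est by (simp add: estimators_def data_space_def)
  have A[measurable]: "?A W \<in> sets ?L" for W by measurable
  have lik0: "cell_lik W \<epsilon> \<omega> \<ge> 0" for W \<epsilon> \<omega>
    unfolding cell_lik_def by (intro prod_nonneg ballI coord_lik_nonneg)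
  have lik[measurable]: "cell_lik W \<epsilon> \<in> borel_measurable ?L" for W \<epsilon>
    unfolding cell_lik_def using pb by (intro borel_measurable_prod measurable_coord_lik) (auto simp: pair_block_def)
  have success: "ennreal (1 - \<eta>) \<le> (\<integral>\<^sup>+\<omega>. ennreal (cell_lik W \<epsilon> \<omega>) * indicator (?A W) \<omega> \<partial>?L)"
    if W: "W \<subseteq> {..<?M}" and \<epsilon>: "\<epsilon> \<in> prior_signs" for W \<epsilon>
  proof -
    let ?P = "data_law n d (theta \<epsilon>) \<sigma> (swap_pairs W)"
    have P: "?P = density ?L (\<lambda>\<omega>. ennreal (cell_lik W \<epsilon> \<omega>))" by (rule data_law_eq_density[OF W])
    interpret P: prob_space ?P
      by (intro prob_space_data_law \<sigma>_pos swap_pairs_permutes W)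
    have sp: "space ?P = space ?L" and se: "sets ?P = sets ?L" by (simp_all add: P)
    have "?A W = space ?P - {\<omega> \<in> space ?P. est \<omega> \<noteq> swap_pairs W}" by (auto simp: sp)
    moreover have "{\<omega> \<in> space ?P. est \<omega> \<noteq> swap_pairs W} \<in> sets ?P"
      unfolding sp se by measurable
    ultimately have "P.prob (?A W) = 1 - err_prob n d (theta \<epsilon>) \<sigma> (swap_pairs W) est"
      unfolding err_prob_def by (simp add: P.prob_compl)
    then have "ennreal (1 - \<eta>) \<le> emeasure ?P (?A W)"
      using err[OF W \<epsilon>] by (simp add: P.emeasure_eq_measure ennreal_leI)
    then show ?thesis by (simp add: P emeasure_density)
  qed
  \<comment> \<open>For \<open>p = ?M\<close> there is no swap to guess: the unpaired block keeps
    its single likelihood, which integrates to 1.\<close>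
  define F where "F p \<omega> = (if p < ?M then max (pair_mix p False \<omega>) (pair_mix p True \<omega>) else pair_mix p False \<omega>)" for p \<omega>
  have F0: "F p \<omega> \<ge> 0" for p \<omega> by (simp add: F_def pair_mix_nonneg max.coboundedI1)
  have mF: "F p \<in> borel_measurable (PiM V (\<lambda>_. lborel))" if "pair_block p \<subseteq> V" for p V
    using measurable_pair_mix[OF that] unfolding F_def by (cases "p < ?M") simp_all
  have F_restrict: "F p (restrict \<omega> (pair_block p)) = F p \<omega>" for p \<omega>
    by (simp add: F_def pair_mix_restrict)
  have le_F: "pair_mix p (p \<in> W) \<omega> \<le> F p \<omega>" if "W \<subseteq> {..<?M}" for p W \<omega>
    using that by (cases "p \<in> W") (auto simp: F_def)
  have "ennreal (2 ^ ?M * ?S) * ennreal (1 - \<eta>) = (\<Sum>W\<in>Pow {..<?M}. \<Sum>\<epsilon>\<in>prior_signs. ennreal (1 - \<eta>))"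
    by (simp add: card_Pow ennreal_mult ennreal_of_nat_eq_real_of_nat mult.assoc flip: ennreal_power)
  also have "\<dots> \<le> (\<Sum>W\<in>Pow {..<?M}. \<Sum>\<epsilon>\<in>prior_signs. \<integral>\<^sup>+\<omega>. ennreal (cell_lik W \<epsilon> \<omega>) * indicator (?A W) \<omega> \<partial>?L)"
    by (intro sum_mono success) auto
  also have "\<dots> = (\<integral>\<^sup>+\<omega>. (\<Sum>W\<in>Pow {..<?M}. \<Sum>\<epsilon>\<in>prior_signs. ennreal (cell_lik W \<epsilon> \<omega>) * indicator (?A W) \<omega>) \<partial>?L)"
    by (subst nn_integral_sum, measurable, subst nn_integral_sum, measurable)
  also have "\<dots> \<le> (\<integral>\<^sup>+\<omega>. ennreal ?S * (\<Prod>p\<le>?M. ennreal (F p \<omega>)) \<partial>?L)"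
  proof (rule nn_integral_mono)
    fix \<omega> assume \<omega>: "\<omega> \<in> space ?L"
    let ?rhs = "ennreal ?S * (\<Prod>p\<le>?M. ennreal (F p \<omega>))"
    have "(\<Sum>W\<in>Pow {..<?M}. \<Sum>\<epsilon>\<in>prior_signs. ennreal (cell_lik W \<epsilon> \<omega>) * indicator (?A W) \<omega>)
      = (\<Sum>W\<in>Pow {..<?M}. ennreal (\<Sum>\<epsilon>\<in>prior_signs. cell_lik W \<epsilon> \<omega>) * indicator (?A W) \<omega>)"
      by (simp add: sum_ennreal lik0 flip: sum_distrib_right)
    also have "\<dots> \<le> (\<Sum>W\<in>Pow {..<?M}. ?rhs * indicator (?A W) \<omega>)"
      unfolding sum_cell_lik using le_F F0 pair_mix_nonneg
      by (intro sum_mono mult_right_mono)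
         (auto simp: prod_ennreal simp flip: ennreal_mult' intro!: ennreal_leI mult_left_mono prod_mono)
    also have "\<dots> = ?rhs * (\<Sum>W\<in>Pow {..<?M}. indicator (?A W) \<omega>)"
      by (simp add: sum_distrib_left)
    also have "(\<Sum>W\<in>Pow {..<?M}. indicator (?A W) \<omega>) \<le> (1 :: ennreal)"
    proof (cases "\<exists>W\<in>Pow {..<?M}. est \<omega> = swap_pairs W")
      case True
      then obtain W where W: "W \<in> Pow {..<?M}" "est \<omega> = swap_pairs W" by blast
      have "(\<Sum>V\<in>Pow {..<?M}. indicator (?A V) \<omega>) = (\<Sum>V\<in>Pow {..<?M}. if V = W then 1 else 0 :: ennreal)"
        using W swap_pairs_inj \<omega> by (intro sum.cong) (auto simp: indicator_def)
      also have "\<dots> = 1" using W by (simp add: sum.delta)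
      finally show ?thesis by simp
    next
      case False
      then have "(\<Sum>V\<in>Pow {..<?M}. indicator (?A V) \<omega>) = (0 :: ennreal)"
        by (intro sum.neutral) (auto simp: indicator_def)
      then show ?thesis by simp
    qed
    finally show "(\<Sum>W\<in>Pow {..<?M}. \<Sum>\<epsilon>\<in>prior_signs. ennreal (cell_lik W \<epsilon> \<omega>) * indicator (?A W) \<omega>) \<le> ?rhs"
      by (simp add: mult_left_mono)
  qed
  also have "\<dots> = ennreal ?S * (\<integral>\<^sup>+\<omega>. (\<Prod>p\<le>?M. ennreal (F p (restrict \<omega> (pair_block p)))) \<partial>PiM (\<Union>p\<le>?M. pair_block p) (\<lambda>_. lborel))"
    unfolding obs_index_eq[symmetric] F_restrict using pb
    by (intro nn_integral_cmult borel_measurable_prod_ennreal measurable_compose[OF mF measurable_ennreal]) auto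
  also have "\<dots> = ennreal ?S * (\<Prod>p\<le>?M. \<integral>\<^sup>+\<omega>. ennreal (F p \<omega>) \<partial>PiM (pair_block p) (\<lambda>_. lborel))"
    using mF by (subst lborel_PiM.product_nn_integral_group[where F = "\<lambda>p \<omega>. ennreal (F p \<omega>)"]) (auto intro!: disjoint_pair_blocks)
  also have "\<dots> \<le> ennreal ?S * (\<Prod>p\<le>?M. if p < ?M then ennreal (2 * ?r) else 1)"
    using nn_integral_max_pair_mix_le[OF _ g aff] nn_integral_pair_mix[of False]
    by (intro mult_left_mono prod_mono_ennreal) (auto simp: F_def)
  also have "(\<Prod>p\<le>?M. if p < ?M then ennreal (2 * ?r) else 1) = ennreal ((2 * ?r) ^ ?M)"
    by (simp add: lessThan_Suc_atMost[symmetric] ennreal_power)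
  \<comment> \<open>There are \<open>2 ^ ?M\<close> choices of \<open>W\<close>, and each pair
    contributes a factor 2 on the right; these powers cancel, as does the number of sign
    arrays.\<close>
  finally have "ennreal (2 ^ ?M * ?S * (1 - \<eta>)) \<le> ennreal (?S * (2 * ?r) ^ ?M)"
    by (simp add: ennreal_mult')
  then have "2 ^ ?M * ?S * (1 - \<eta>) \<le> ?S * (2 * ?r) ^ ?M"
    by (subst (asm) ennreal_le_iff) auto
  then have "(2 ^ ?M * ?S) * (1 - \<eta>) \<le> (2 ^ ?M * ?S) * ?r ^ ?M"
    by (simp add: power_mult_distrib mult_ac)
  then show ?thesis
    using card_prior_signs by (subst (asm) mult_le_cancel_left_pos) auto
qed

section \<open>The affinity in one coordinate of a pair\<close>

lemma block_eq:
  assumes "p < n div 2"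
  shows "block p k = {(False, 2 * p, k), (False, 2 * p + 1, k), (True, 2 * p, k), (True, 2 * p + 1, k)}"
proof -
  have "{i. i < n \<and> i div 2 = p} = {2 * p, 2 * p + 1}" using assms by auto
  then show ?thesis by (auto simp: block_def)
qed

lemma prod_block:
  "p < n div 2 \<Longrightarrow> (\<Prod>x\<in>block p k. h x)
    = h (False, 2 * p, k) * (h (False, 2 * p + 1, k) * (h (True, 2 * p, k) * h (True, 2 * p + 1, k)))" for h :: "_ \<Rightarrow> real"
  by (simp add: block_eq)

lemma sum_block:
  "p < n div 2 \<Longrightarrow> (\<Sum>x\<in>block p k. h x)
    = h (False, 2 * p, k) + (h (False, 2 * p + 1, k) + (h (True, 2 * p, k) + h (True, 2 * p + 1, k)))" for h :: "_ \<Rightarrow> real"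
  by (simp add: block_eq)

lemma item_block [simp]:
  "item w (False, i, k) = i" "item False x = fst (snd x)"
  "item True (True, 2 * p, k) = Suc (2 * p)" "item True (True, Suc (2 * p), k) = 2 * p"
  by (auto simp: item_def partner_def)

lemma offset_block [simp]:
  "offset w (False, 2 * p, k) = a p" "offset w (False, Suc (2 * p), k) = - a p"
  "offset False (b, 2 * p, k) = a p" "offset False (b, Suc (2 * p), k) = - a p"
  "offset True (True, 2 * p, k) = - a p" "offset True (True, Suc (2 * p), k) = a p"
  by (simp_all add: offset_def)

text \<open>The two observations of the first sample have the same law with and without swap and
  contribute 1. Each one of the second sample sees a mean gap of 2 a and the variances
  \<open>s\<^sup>2\<close> and \<open>t\<^sup>2\<close> in either order, and contributes the square
  root of the claimed value.\<close>

lemma affinity_coord_mix_single: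
  assumes p: "p < n div 2" and T1: "T = {1}"
  defines "s \<equiv> \<sigma> (2 * p)" and "t \<equiv> \<sigma> (2 * p + 1)"
  shows "(\<integral>\<^sup>+\<omega>. ennreal (sqrt (coord_mix p k False \<omega> * coord_mix p k True \<omega>)) \<partial>PiM (block p k) (\<lambda>_. lborel))
    = ennreal (2 * s * t / (s\<^sup>2 + t\<^sup>2) * exp (- 2 * (a p)\<^sup>2 / (s\<^sup>2 + t\<^sup>2)))"
proof -
  have st: "s > 0" "t > 0" using p \<sigma>_pos by (auto simp: s_def t_def)
  let ?Z = "2 * s * t / (s\<^sup>2 + t\<^sup>2)" and ?e = "exp (- (a p)\<^sup>2 / (s\<^sup>2 + t\<^sup>2))"
  have Z0: "?Z \<ge> 0" using st by (intro divide_nonneg_nonneg) auto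
  have pos: "\<sigma> (item w x) > 0" if "x \<in> block p k" for w x
    using that p by (rule item_pos)
  have "(\<integral>\<^sup>+\<omega>. ennreal (sqrt (coord_mix p k False \<omega> * coord_mix p k True \<omega>)) \<partial>PiM (block p k) (\<lambda>_. lborel))
    = ennreal (\<Prod>x\<in>block p k. sqrt (2 * \<sigma> (item False x) * \<sigma> (item True x) / ((\<sigma> (item False x))\<^sup>2 + (\<sigma> (item True x))\<^sup>2))
        * exp (- ((\<beta> p + 1 * offset False x) - (\<beta> p + 1 * offset True x))\<^sup>2 / (4 * ((\<sigma> (item False x))\<^sup>2 + (\<sigma> (item True x))\<^sup>2))))"
    unfolding coord_mix_def coord_lik_def unfolding T1 using pos[of _ False] pos[of _ True]
    by (subst affinity_normal_prod[symmetric]) simp_all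
  also have "\<dots> = ennreal ((sqrt ?Z * ?e) * (sqrt ?Z * ?e))"
  proof -
    have Z1: "sqrt (2 * v * v / (v\<^sup>2 + v\<^sup>2)) = 1" if "v > 0" for v :: real
      using that by (simp add: power2_eq_square)
    have e: "exp (- ((\<beta> p + 1 * c) - (\<beta> p + 1 * (- c)))\<^sup>2 / (4 * q)) = exp (- c\<^sup>2 / q)" for c q :: real
      by (simp add: power2_eq_square)
    have e': "exp (- ((\<beta> p + 1 * (- c)) - (\<beta> p + 1 * c))\<^sup>2 / (4 * q)) = exp (- c\<^sup>2 / q)" for c q :: real
      by (simp add: power2_eq_square)
    have comm: "2 * t * s = 2 * s * t" "t\<^sup>2 + s\<^sup>2 = s\<^sup>2 + t\<^sup>2" by simp_all
    show ?thesis
      unfolding prod_block[OF p]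
      by (simp only: item_block offset_block fst_conv snd_conv e e' Suc_eq_plus1[symmetric])
         (simp only: Suc_eq_plus1 s_def[symmetric] t_def[symmetric] Z1[OF st(1)] Z1[OF st(2)] comm, simp)
  qed
  also have "(sqrt ?Z * ?e) * (sqrt ?Z * ?e) = ?Z * exp (- 2 * (a p)\<^sup>2 / (s\<^sup>2 + t\<^sup>2))"
  proof -
    have "sqrt ?Z * sqrt ?Z = ?Z" by (simp only: real_sqrt_mult_self abs_of_nonneg[OF Z0])
    moreover have "?e * ?e = exp (- 2 * (a p)\<^sup>2 / (s\<^sup>2 + t\<^sup>2))" by (simp add: exp_add[symmetric])
    moreover have "(u * v) * (u * v) = (u * u) * (v * v)" for u v :: real by (simp only: mult_ac)
    ultimately show ?thesis by (simp only:)
  qed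
  finally show ?thesis .
qed

text \<open>The constants come from V \<le> 3 E: \<open>affinity_constant_ge\<close> requires V
  \<le> 1/10 and loses 6 V^2 \<le> 54 E^2. \<open>E\<close> is the sum of a^2 / (2 variance) over
  the four observations, the same for both hypotheses.\<close>

lemma affinity_coord_mix_signs:
  assumes p: "p < n div 2" and T2: "T = {1, -1}"
  defines "s \<equiv> \<sigma> (2 * p)" and "t \<equiv> \<sigma> (2 * p + 1)"
  defines "E \<equiv> (a p)\<^sup>2 * (s\<^sup>2 + t\<^sup>2) / (s\<^sup>2 * t\<^sup>2)"
  assumes E: "E \<le> 1/30"
  shows "ennreal (2 * s * t / (s\<^sup>2 + t\<^sup>2) * exp (- 54 * E\<^sup>2))
    \<le> (\<integral>\<^sup>+\<omega>. ennreal (sqrt (coord_mix p k False \<omega> * coord_mix p k True \<omega>)) \<partial>PiM (block p k) (\<lambda>_. lborel))"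
proof -
  have st: "s > 0" "t > 0" using p \<sigma>_pos by (auto simp: s_def t_def)
  define A where "A = (a p)\<^sup>2"
  define \<tau> where "\<tau> x = sqrt (2 * (\<sigma> (item False x))\<^sup>2 * (\<sigma> (item True x))\<^sup>2 / ((\<sigma> (item False x))\<^sup>2 + (\<sigma> (item True x))\<^sup>2))" for x
  have \<tau>: "(\<tau> x)\<^sup>2 = 2 * (\<sigma> (item False x))\<^sup>2 * (\<sigma> (item True x))\<^sup>2 / ((\<sigma> (item False x))\<^sup>2 + (\<sigma> (item True x))\<^sup>2)" for x
    unfolding \<tau>_def by (intro real_sqrt_pow2) simp
  \<comment> \<open>The first summand comes from the first sample, where \<tau> is the noise level
    itself; the second from the second sample, where \<tau>^2 is the harmonic mean of the two
    variances.\<close>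
  define V where "V = E + 2 * A * (s ^ 4 + t ^ 4) / (s\<^sup>2 * t\<^sup>2 * (s\<^sup>2 + t\<^sup>2))"
  have D: "s\<^sup>2 + t\<^sup>2 > 0" "s\<^sup>2 > 0" "t\<^sup>2 > 0" using st by (auto simp: add_pos_pos)
  have A0: "A \<ge> 0" by (simp add: A_def)
  have E_eq: "E = A * (s\<^sup>2 + t\<^sup>2)\<^sup>2 / (s\<^sup>2 * t\<^sup>2 * (s\<^sup>2 + t\<^sup>2))"
    using D unfolding E_def A_def by (simp add: power2_eq_square[of "s\<^sup>2 + t\<^sup>2"])
  have E0: "E \<ge> 0" unfolding E_def by (intro divide_nonneg_nonneg mult_nonneg_nonneg) auto
  have st4: "s ^ 4 = (s\<^sup>2)\<^sup>2" "t ^ 4 = (t\<^sup>2)\<^sup>2" by simp_all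
  \<comment> \<open>Unequal variances can only push \<open>V\<close> above 2 E, which is the
    direction that \<open>affinity_constant_ge\<close> needs.\<close>
  have "2 * E \<le> V"
  proof -
    have "(s\<^sup>2 + t\<^sup>2)\<^sup>2 \<le> 2 * (s ^ 4 + t ^ 4)"
      unfolding st4 using zero_le_power2[of "s\<^sup>2 - t\<^sup>2"] by (simp only: power2_sum power2_diff) simp
    then have "A * (s\<^sup>2 + t\<^sup>2)\<^sup>2 \<le> A * (2 * (s ^ 4 + t ^ 4))" using A0 by (rule mult_left_mono)
    then have "E \<le> 2 * A * (s ^ 4 + t ^ 4) / (s\<^sup>2 * t\<^sup>2 * (s\<^sup>2 + t\<^sup>2))"
      unfolding E_eq by (intro divide_right_mono) (auto simp: mult_ac)
    then show ?thesis by (simp add: V_def)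
  qed
  have V3: "V \<le> 3 * E"
  proof -
    have "s ^ 4 + t ^ 4 \<le> (s\<^sup>2 + t\<^sup>2)\<^sup>2"
      unfolding st4 by (simp add: power2_sum)
    then have "2 * A * (s ^ 4 + t ^ 4) \<le> 2 * A * (s\<^sup>2 + t\<^sup>2)\<^sup>2" using A0 by (intro mult_left_mono) auto
    then have "2 * A * (s ^ 4 + t ^ 4) / (s\<^sup>2 * t\<^sup>2 * (s\<^sup>2 + t\<^sup>2)) \<le> 2 * E"
      unfolding E_eq by (simp add: divide_right_mono)
    then show ?thesis by (simp add: V_def)
  qed
  have sumE: "(\<Sum>x\<in>block p k. (offset w x)\<^sup>2 / (2 * (\<sigma> (item w x))\<^sup>2)) = E" for w
    using D by (cases w) (simp_all add: sum_block[OF p] E_def divide_simps flip: s_def t_def[unfolded Suc_eq_plus1[symmetric]],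
      simp_all add: algebra_simps)
  have sumV: "(\<Sum>x\<in>block p k. (offset w x / (\<sigma> (item w x))\<^sup>2)\<^sup>2 * (\<tau> x)\<^sup>2) = V" for w
  proof -
    have same: "2 * v * v / (v + v) = v" for v :: real by simp
    have comm: "2 * t\<^sup>2 * s\<^sup>2 / (t\<^sup>2 + s\<^sup>2) = 2 * s\<^sup>2 * t\<^sup>2 / (s\<^sup>2 + t\<^sup>2)" by (simp add: mult_ac add_ac)
    have alg: "A / S\<^sup>2 * S + (A / Q\<^sup>2 * Q + (A / S\<^sup>2 * (2 * S * Q / (S + Q)) + A / Q\<^sup>2 * (2 * S * Q / (S + Q))))
      = A * (S + Q) / (S * Q) + 2 * A * (S\<^sup>2 + Q\<^sup>2) / (S * Q * (S + Q))" if "S > 0" "Q > 0" for S Q :: real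
    proof -
      have 1: "A / S\<^sup>2 * (2 * S * Q / R) + A / Q\<^sup>2 * (2 * S * Q / R) = 2 * A * (S\<^sup>2 + Q\<^sup>2) / (S * Q * R)" if "R > 0" for R
        using that \<open>S > 0\<close> \<open>Q > 0\<close> by (simp add: field_simps power2_eq_square)
      have 2: "A / S\<^sup>2 * S + A / Q\<^sup>2 * Q = A * (S + Q) / (S * Q)"
        using that by (simp add: field_simps power2_eq_square)
      have 3: "S + Q > 0" using that by simp
      show ?thesis unfolding 1[OF 3] 2[symmetric] by (rule add.assoc[symmetric])
    qed
    have "(\<Sum>x\<in>block p k. (offset w x / (\<sigma> (item w x))\<^sup>2)\<^sup>2 * (\<tau> x)\<^sup>2)
      = A / (s\<^sup>2)\<^sup>2 * s\<^sup>2 + (A / (t\<^sup>2)\<^sup>2 * t\<^sup>2 + (A / (s\<^sup>2)\<^sup>2 * (2 * s\<^sup>2 * t\<^sup>2 / (s\<^sup>2 + t\<^sup>2)) + A / (t\<^sup>2)\<^sup>2 * (2 * s\<^sup>2 * t\<^sup>2 / (s\<^sup>2 + t\<^sup>2))))"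
    proof (cases w)
      case True
      show ?thesis
        unfolding sum_block[OF p] \<tau>
        apply (simp only: True item_block offset_block fst_conv snd_conv Suc_eq_plus1[symmetric] power_divide power2_minus A_def[symmetric])
        apply (simp only: Suc_eq_plus1 s_def[symmetric] t_def[symmetric] same comm)
        done
    next
      case False
      show ?thesis
        unfolding sum_block[OF p] \<tau>
        apply (simp only: False item_block offset_block fst_conv snd_conv Suc_eq_plus1[symmetric] power_divide power2_minus A_def[symmetric])
        apply (simp only: Suc_eq_plus1 s_def[symmetric] t_def[symmetric] same comm)
        done
    qed
    also have "\<dots> = V" unfolding alg[OF D(2,3)] V_def E_def A_def[symmetric] st4 ..
    finally show ?thesis .
  qed
  have prodZ: "(\<Prod>x\<in>block p k. sqrt (2 * \<sigma> (item False x) * \<sigma> (item True x) / ((\<sigma> (item False x))\<^sup>2 + (\<sigma> (item True x))\<^sup>2)))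
      = 2 * s * t / (s\<^sup>2 + t\<^sup>2)"
  proof -
    have Z1: "sqrt (2 * v * v / (v\<^sup>2 + v\<^sup>2)) = 1" if "v > 0" for v :: real
      using that by (simp add: power2_eq_square)
    have comm: "2 * t * s = 2 * s * t" "t\<^sup>2 + s\<^sup>2 = s\<^sup>2 + t\<^sup>2" by simp_all
    have "2 * s * t / (s\<^sup>2 + t\<^sup>2) \<ge> 0" using st by (intro divide_nonneg_nonneg) auto
    then have "sqrt (2 * s * t / (s\<^sup>2 + t\<^sup>2)) * sqrt (2 * s * t / (s\<^sup>2 + t\<^sup>2)) = 2 * s * t / (s\<^sup>2 + t\<^sup>2)"
      by (simp only: real_sqrt_mult_self abs_of_nonneg)
    then show ?thesis
      unfolding prod_block[OF p]
      by (simp only: item_block fst_conv snd_conv Suc_eq_plus1[symmetric])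
         (simp only: Suc_eq_plus1 s_def[symmetric] t_def[symmetric] Z1[OF st(1)] Z1[OF st(2)] comm mult_1_left)
  qed
  have V0: "V \<ge> 0" using \<open>2 * E \<le> V\<close> E0 by simp
  have "exp (- 54 * E\<^sup>2) \<le> exp (- 6 * V\<^sup>2)"
  proof -
    have "V\<^sup>2 \<le> (3 * E)\<^sup>2" using V3 V0 by (intro power_mono)
    then show ?thesis by (simp add: power_mult_distrib)
  qed
  also have "\<dots> \<le> exp (- E) * (5 * exp (V / 2) - (exp (2 * V) + 3))"
    using E E0 V3 \<open>2 * E \<le> V\<close> by (intro affinity_constant_ge) auto
  finally have "ennreal (2 * s * t / (s\<^sup>2 + t\<^sup>2) * exp (- 54 * E\<^sup>2))
     \<le> ennreal (2 * s * t / (s\<^sup>2 + t\<^sup>2) * exp (- E) * (5 * exp (V / 2) - (exp (2 * V) + 3)))"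
    unfolding mult.assoc[of "2 * s * t / (s\<^sup>2 + t\<^sup>2)"] using st
    by (intro ennreal_leI mult_left_mono) (auto intro!: divide_nonneg_nonneg)
  also have "\<dots> \<le> (\<integral>\<^sup>+\<omega>. ennreal (sqrt (coord_mix p k False \<omega> * coord_mix p k True \<omega>)) \<partial>PiM (block p k) (\<lambda>_. lborel))"
  proof -
    have card: "real (card {1, -1 :: real}) = 2" by simp
    show ?thesis
      unfolding coord_mix_def coord_lik_def unfolding T2 card prodZ[symmetric]
      by (intro affinity_symmetrized_normal_prod_ge[where \<tau> = \<tau>] \<tau> sumE sumV finite_block item_pos[OF _ p])
  qed
  finally show ?thesis .
qed

end

subsection \<open>The lower bound\<close>

lemma err_prob_le_1:
  "(\<And>i. i < n \<Longrightarrow> \<sigma> i > 0) \<Longrightarrow> \<pi> permutes {0..<n} \<Longrightarrow> err_prob n d \<theta> \<sigma> \<pi> est \<le> 1"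
  unfolding err_prob_def by (intro prob_space.prob_le_1 prob_space_data_law)

section \<open>Separation of the prior configurations\<close>

lemma rel_sep_geI:
  assumes "n \<ge> 2" and \<sigma>: "\<And>i. i < n \<Longrightarrow> \<sigma> i > 0"
    and dist: "\<And>i j. i < n \<Longrightarrow> j < n \<Longrightarrow> i \<noteq> j \<Longrightarrow> K * sqrt ((\<sigma> i)\<^sup>2 + (\<sigma> j)\<^sup>2) \<le> theta_dist d \<theta> i j"
  shows "K \<le> rel_sep n d \<theta> \<sigma>"
proof -
  let ?f = "\<lambda>(i, j). theta_dist d \<theta> i j / sqrt ((\<sigma> i)\<^sup>2 + (\<sigma> j)\<^sup>2)"
  let ?P = "{(i, j). i < n \<and> j < n \<and> i \<noteq> j}"
  have eq: "{theta_dist d \<theta> i j / sqrt ((\<sigma> i)\<^sup>2 + (\<sigma> j)\<^sup>2) | i j. i < n \<and> j < n \<and> i \<noteq> j} = ?f ` ?P"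
    by auto
  have "finite ?P" by (rule finite_subset[of _ "{..<n} \<times> {..<n}"]) auto
  moreover have "(0, 1) \<in> ?P" using assms(1) by auto
  moreover have "K \<le> y" if "y \<in> ?f ` ?P" for y
  proof -
    have "\<exists>i j. y = theta_dist d \<theta> i j / sqrt ((\<sigma> i)\<^sup>2 + (\<sigma> j)\<^sup>2) \<and> i < n \<and> j < n \<and> i \<noteq> j"
      using that unfolding eq[symmetric] by simp
    then obtain i j where ij: "i < n" "j < n" "i \<noteq> j" "y = theta_dist d \<theta> i j / sqrt ((\<sigma> i)\<^sup>2 + (\<sigma> j)\<^sup>2)"
      by blast
    have "sqrt ((\<sigma> i)\<^sup>2 + (\<sigma> j)\<^sup>2) > 0" using \<sigma>[OF ij(1)] by (simp add: add_pos_nonneg)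
    then show ?thesis using dist[OF ij(1-3)] ij(4) by (simp add: pos_le_divide_eq)
  qed
  ultimately show ?thesis
    unfolding rel_sep_def eq by (subst Min_ge_iff) auto
qed

lemma theta_dist_ge_coord: "k < d \<Longrightarrow> \<bar>\<theta> i k - \<theta> j k\<bar> \<le> theta_dist d \<theta> i j"
  unfolding theta_dist_def
  by (rule real_le_rsqrt) (auto intro!: member_le_sum[where f = "\<lambda>k. (\<theta> i k - \<theta> j k)\<^sup>2"])

text \<open>Within a pair every coordinate differs by 2 a in absolute value, whatever the signs, so
  the distance is exactly \<open>K\<close> times the noise scale. Between pairs one coordinate
  suffices: the centres are at least 3 D apart with D = K sqrt(2 R), the two offsets take away at
  most D each, and the remaining D dominates every required distance.\<close>

lemma (in paired_prior) rel_sep_theta_ge: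
  assumes nd: "n \<ge> 2" "d \<ge> 1" and K: "K \<ge> 0" and T': "T \<subseteq> {1, -1}" and \<epsilon>: "\<epsilon> \<in> prior_signs"
    and a: "\<And>p. p < n div 2 \<Longrightarrow> a p = K * sqrt (((\<sigma> (2 * p))\<^sup>2 + (\<sigma> (2 * p + 1))\<^sup>2) / (4 * d))"
      "\<And>p. p \<ge> n div 2 \<Longrightarrow> a p = 0"
    and R: "\<And>i. i < n \<Longrightarrow> (\<sigma> i)\<^sup>2 \<le> R"
    and \<beta>: "\<And>p. \<beta> p = 3 * (K * sqrt (2 * R)) * real p"
  shows "K \<le> rel_sep n d (theta \<epsilon>) \<sigma>"
proof (rule rel_sep_geI)
  let ?D = "K * sqrt (2 * R)"
  have R0: "R \<ge> 0" using R[of 0] nd zero_le_power2[of "\<sigma> 0"] by linarith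
  have D0: "?D \<ge> 0" using K R0 by simp
  have sgn: "\<epsilon> (p, k) \<in> {1, -1}" if "p \<le> n div 2" "k < d" for p k
    using \<epsilon> T' that unfolding prior_signs_def by (auto simp: PiE_iff)
  have a_le: "\<bar>a p\<bar> \<le> ?D" for p
  proof (cases "p < n div 2")
    case True
    then have "2 * p < n" "2 * p + 1 < n" by auto
    then have "(\<sigma> (2 * p))\<^sup>2 + (\<sigma> (2 * p + 1))\<^sup>2 \<le> 2 * R"
      using R[of "2 * p"] R[of "2 * p + 1"] by linarith
    moreover have "4 * real d \<ge> 1" using nd by simp
    ultimately have "((\<sigma> (2 * p))\<^sup>2 + (\<sigma> (2 * p + 1))\<^sup>2) / (4 * d) \<le> 2 * R / 1"
      by (intro frac_le) (auto simp: R0)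
    then show ?thesis using a(1)[OF True] K by (simp add: abs_mult mult_left_mono)
  qed (use a(2) D0 in simp)
  fix i j assume ij: "i < n" "j < n" "i \<noteq> j"
  have le: "i div 2 \<le> n div 2" "j div 2 \<le> n div 2" using ij by (simp_all add: div_le_mono)
  show "K * sqrt ((\<sigma> i)\<^sup>2 + (\<sigma> j)\<^sup>2) \<le> theta_dist d (theta \<epsilon>) i j"
  proof (cases "i div 2 = j div 2")
    case True
    define p where "p = i div 2"
    have cases: "i = 2 * p \<and> j = 2 * p + 1 \<or> i = 2 * p + 1 \<and> j = 2 * p"
      using True ij(3) unfolding p_def by presburger
    then have p: "p < n div 2" using ij by auto
    have sum: "(\<sigma> (2 * p))\<^sup>2 + (\<sigma> (2 * p + 1))\<^sup>2 = (\<sigma> i)\<^sup>2 + (\<sigma> j)\<^sup>2" using cases by auto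
    have "(theta \<epsilon> i k - theta \<epsilon> j k)\<^sup>2 = 4 * (a p)\<^sup>2" if "k < d" for k
    proof -
      have "(theta \<epsilon> i k - theta \<epsilon> j k)\<^sup>2 = (2 * (\<epsilon> (p, k) * a p))\<^sup>2"
        using cases by (auto simp: theta_def power2_eq_square)
      also have "\<dots> = 4 * (a p)\<^sup>2"
        using sgn[OF _ that, of p] p by (auto simp: power2_eq_square)
      finally show ?thesis .
    qed
    then have "(\<Sum>k<d. (theta \<epsilon> i k - theta \<epsilon> j k)\<^sup>2) = real d * (4 * (a p)\<^sup>2)" by simp
    also have "(a p)\<^sup>2 = K\<^sup>2 * (((\<sigma> i)\<^sup>2 + (\<sigma> j)\<^sup>2) / (4 * d))"
      unfolding a(1)[OF p] sum by (simp add: power_mult_distrib)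
    also have "real d * (4 * (K\<^sup>2 * (((\<sigma> i)\<^sup>2 + (\<sigma> j)\<^sup>2) / (4 * d)))) = K\<^sup>2 * ((\<sigma> i)\<^sup>2 + (\<sigma> j)\<^sup>2)"
      using nd by simp
    finally have "theta_dist d (theta \<epsilon>) i j = K * sqrt ((\<sigma> i)\<^sup>2 + (\<sigma> j)\<^sup>2)"
      unfolding theta_dist_def using K by (simp add: real_sqrt_mult)
    then show ?thesis by simp
  next
    case False
    let ?u = "\<lambda>i. \<epsilon> (i div 2, 0) * ((if even i then 1 else - 1) * a (i div 2))"
    have u: "\<bar>?u l\<bar> \<le> ?D" if "l div 2 \<le> n div 2" for l
      using sgn[OF that, of 0] nd a_le[of "l div 2"] by (auto simp: abs_mult)
    have "\<bar>real (i div 2) - real (j div 2)\<bar> \<ge> 1" using False by linarith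
    then have "3 * ?D * 1 \<le> 3 * ?D * \<bar>real (i div 2) - real (j div 2)\<bar>" using D0 by (intro mult_left_mono) auto
    also have "\<dots> = \<bar>\<beta> (i div 2) - \<beta> (j div 2)\<bar>"
      unfolding \<beta> right_diff_distrib[symmetric] abs_mult using D0 K R0 by simp
    finally have "?D \<le> \<bar>theta \<epsilon> i 0 - theta \<epsilon> j 0\<bar>"
      using u[OF le(1)] u[OF le(2)] unfolding theta_def by linarith
    also have "\<dots> \<le> theta_dist d (theta \<epsilon>) i j" using nd by (intro theta_dist_ge_coord) simp
    finally have "?D \<le> theta_dist d (theta \<epsilon>) i j" .
    moreover have "K * sqrt ((\<sigma> i)\<^sup>2 + (\<sigma> j)\<^sup>2) \<le> ?D"
      using R[OF ij(1)] R[OF ij(2)] K by (intro mult_left_mono) auto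
    ultimately show ?thesis by simp
  qed
qed (use nd \<sigma>_pos in auto)

text \<open>With S = s^2 and Q = t^2 the left side is the inverse square of the variance factor 2 s
  t / (s^2 + t^2). Its excess over 1 is quadratic in the relative difference, so a spread \<delta>
  of order sqrt(log n / d) costs only order log n / d per coordinate.\<close>

lemma variance_ratio_bound:
  fixes S Q m M \<delta> :: real
  assumes "0 < m" "m \<le> S" "S \<le> M" "m \<le> Q" "Q \<le> M" and \<delta>: "M / m - 1 \<le> \<delta>"
  shows "(S + Q)\<^sup>2 / (4 * S * Q) \<le> exp (\<delta>\<^sup>2 / 4)"
proof -
  have pos: "S > 0" "Q > 0" using assms by auto
  have "(S + Q)\<^sup>2 / (4 * S * Q) = 1 + (S - Q)\<^sup>2 / (4 * S * Q)"
    using pos by (simp add: field_simps power2_eq_square)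
  also have "(S - Q)\<^sup>2 / (4 * S * Q) \<le> (M - m)\<^sup>2 / (4 * m * m)"
    using assms pos by (intro frac_le mult_mono power2_le_iff_abs_le[THEN iffD2]) auto
  also have "(M - m)\<^sup>2 / (4 * m * m) = (M / m - 1)\<^sup>2 / 4"
    using assms by (simp add: field_simps power2_eq_square)
  also have "\<dots> \<le> \<delta>\<^sup>2 / 4"
    using assms by (intro divide_right_mono power_mono) auto
  also have "1 + \<delta>\<^sup>2 / 4 \<le> exp (\<delta>\<^sup>2 / 4)" by simp
  finally show ?thesis by simp
qed

text \<open>The prior sits exactly at the threshold separation, with c = 1; its configurations are
  admissible for every smaller \<kappa>, so one computation serves all.\<close>

lemma max_error_ge:
  fixes n d :: nat and \<sigma> :: "nat \<Rightarrow> real" and \<eta> :: real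
  assumes nd: "n \<ge> 2" "d \<ge> 1" and \<sigma>: "\<And>i. i < n \<Longrightarrow> \<sigma> i > 0"
    and ratio: "(Max {(\<sigma> i)\<^sup>2 | i. i < n}) / (Min {(\<sigma> i)\<^sup>2 | i. i < n}) - 1 \<le> 1/4 * sqrt (ln (real n) / real d)"
    and K: "K = 1/8 * max (sqrt (ln (real n))) ((real d * ln (real n)) powr (1/4))"
    and est: "est \<in> estimators n d"
    and err: "\<And>\<pi> \<theta>. \<pi> permutes {0..<n} \<Longrightarrow> K \<le> rel_sep n d \<theta> \<sigma> \<Longrightarrow> err_prob n d \<theta> \<sigma> \<pi> est \<le> \<eta>"
  shows "1/13 \<le> \<eta>"
proof -
  define L where "L = ln (real n)"
  define q where "q = L / real d"
  have L: "L > 0" using nd by (simp add: L_def)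
  have d: "real d \<ge> 1" using nd by simp
  have L4: "(L\<^sup>2) powr (1/4) = sqrt L"
  proof -
    have "(L\<^sup>2) powr (1/4) = (L powr 2) powr (1/4)" using L by simp
    also have "\<dots> = L powr (1/2)" by (subst powr_powr) simp
    also have "\<dots> = sqrt L" using L by (intro powr_half_sqrt) simp
    finally show ?thesis .
  qed
  have q0: "q > 0" using L d by (simp add: q_def)
  have K0: "K \<ge> 0" unfolding K by (simp add: le_max_iff_disj)
  let ?V = "{(\<sigma> i)\<^sup>2 | i. i < n}"
  define R where "R = Max ?V"
  have V: "finite ?V" "?V \<noteq> {}" using nd by (auto intro: exI[of _ 0])
  have R: "(\<sigma> i)\<^sup>2 \<le> R" and m: "Min ?V \<le> (\<sigma> i)\<^sup>2" if "i < n" for i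
    using V that unfolding R_def by (auto intro!: Max_ge Min_le)
  have m0: "Min ?V > 0"
  proof -
    have "0 < y" if "y \<in> ?V" for y
    proof -
      obtain i where "i < n" "y = (\<sigma> i)\<^sup>2" using \<open>y \<in> ?V\<close> by blast
      then show ?thesis using \<sigma>[of i] by simp
    qed
    then show ?thesis unfolding Min_gr_iff[OF V] by blast
  qed
  \<comment> \<open>The switch at d = log n is where the two terms of the maximum in
    \<open>K\<close> coincide.\<close>
  define T :: "real set" where "T = (if real d \<le> L then {1} else {1, -1})"
  define a where "a p = (if p < n div 2 then K * sqrt (((\<sigma> (2 * p))\<^sup>2 + (\<sigma> (2 * p + 1))\<^sup>2) / (4 * d)) else 0)" for p
  define \<beta> where "\<beta> p = 3 * (K * sqrt (2 * R)) * real p" for p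
  interpret paired_prior n d \<sigma> \<beta> a T
    by standard (auto simp: \<sigma> T_def)
  \<comment> \<open>The budget q / 16 is shared: unequal variances cost q / 128, the offsets another
    q / 128 in the deterministic case and at most 54 q / 1024 with random signs.\<close>
  have aff: "ennreal (exp (- (q / 16))) \<le> (\<integral>\<^sup>+\<omega>. ennreal (sqrt (coord_mix p k False \<omega> * coord_mix p k True \<omega>)) \<partial>PiM (block p k) (\<lambda>_. lborel))"
    if p: "p < n div 2" for p k
  proof -
    let ?s = "\<sigma> (2 * p)" and ?t = "\<sigma> (2 * p + 1)"
    have pn: "2 * p < n" "2 * p + 1 < n" using p by auto
    have st: "?s > 0" "?t > 0" using pn by (auto intro: \<sigma>)
    define D where "D = ?s\<^sup>2 + ?t\<^sup>2"
    have D: "D > 0" using st by (simp add: D_def add_pos_pos)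
    have a2: "(a p)\<^sup>2 = K\<^sup>2 * (D / (4 * d))"
      using p by (simp add: a_def D_def power_mult_distrib)
    define Z where "Z = 2 * ?s * ?t / D"
    have Z0: "Z > 0" using st D by (simp add: Z_def)
    have Q: "D\<^sup>2 / (4 * ?s\<^sup>2 * ?t\<^sup>2) \<le> exp (q / 64)"
    proof -
      have "D\<^sup>2 / (4 * ?s\<^sup>2 * ?t\<^sup>2) \<le> exp ((1/4 * sqrt (L / real d))\<^sup>2 / 4)"
        unfolding D_def using R[OF pn(1)] R[OF pn(2)] m[OF pn(1)] m[OF pn(2)] m0 ratio
        by (intro variance_ratio_bound[of "Min ?V" _ R]) (auto simp: L_def R_def)
      also have "(1/4 * sqrt (L / real d))\<^sup>2 / 4 = q / 64"
        using L d by (simp add: q_def power_mult_distrib power_divide)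
      finally show ?thesis .
    qed
    have Z: "exp (- (q / 128)) \<le> Z"
    proof (rule power2_le_imp_le)
      have "Z\<^sup>2 = inverse (D\<^sup>2 / (4 * ?s\<^sup>2 * ?t\<^sup>2))"
        by (simp add: Z_def power_divide power_mult_distrib)
      also have "\<dots> \<ge> inverse (exp (q / 64))"
        using Q st D by (intro le_imp_inverse_le) auto
      finally show "(exp (- (q / 128)))\<^sup>2 \<le> Z\<^sup>2"
        by (simp add: exp_minus[symmetric] exp_double[symmetric])
    qed (use Z0 in simp)
    show ?thesis
    proof (cases "real d \<le> L")
      case True
      then have T1: "T = {1}" by (simp add: T_def)
      have "(real d * L) powr (1/4) \<le> (L\<^sup>2) powr (1/4)"
        using True L by (intro powr_mono2) (auto simp: power2_eq_square)
      also have "\<dots> = sqrt L" by (rule L4)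
      finally have "K = 1/8 * sqrt L" unfolding K L_def by (simp add: max_def)
      then have "K\<^sup>2 = (1/8 * sqrt L)\<^sup>2" by (simp only:)
      also have "\<dots> = L / 64" using L by (simp add: power_mult_distrib power_divide)
      finally have K2: "K\<^sup>2 = L / 64" .
      have e: "- 2 * (a p)\<^sup>2 / D = - (q / 128)"
        unfolding a2 K2 q_def using D d by (simp add: field_simps)
      have "(\<integral>\<^sup>+\<omega>. ennreal (sqrt (coord_mix p k False \<omega> * coord_mix p k True \<omega>)) \<partial>PiM (block p k) (\<lambda>_. lborel))
        = ennreal (Z * exp (- (q / 128)))"
        unfolding affinity_coord_mix_single[OF p T1] D_def[symmetric] e Z_def ..
      moreover have "exp (- (q / 16)) \<le> Z * exp (- (q / 128))"
      proof -
        have "exp (- (q / 16)) \<le> exp (- (q / 128)) * exp (- (q / 128))"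
          using q0 by (simp flip: exp_add)
        also have "\<dots> \<le> Z * exp (- (q / 128))"
          using Z by (intro mult_right_mono) auto
        finally show ?thesis .
      qed
      ultimately show ?thesis by (simp only: ennreal_leI)
    next
      case False
      then have T2: "T = {1, -1}" by (simp add: T_def)
      have q1: "q \<le> 1" using False d by (simp add: q_def)
      have "sqrt L = (L\<^sup>2) powr (1/4)" by (rule L4[symmetric])
      also have "\<dots> \<le> (real d * L) powr (1/4)"
        using False L by (intro powr_mono2) (auto simp: power2_eq_square)
      finally have "K = 1/8 * (real d * L) powr (1/4)" unfolding K L_def by (simp add: max_def)
      then have "K\<^sup>2 = (1/8 * (real d * L) powr (1/4))\<^sup>2" by (simp only:)
      also have "\<dots> = 1/64 * ((real d * L) powr (1/4))\<^sup>2" by (simp add: power_mult_distrib power_divide)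
      also have "((real d * L) powr (1/4))\<^sup>2 = sqrt (real d * L)"
        using L d unfolding power2_eq_square powr_add[symmetric] by (simp add: powr_half_sqrt)
      finally have K2: "K\<^sup>2 = sqrt (real d * L) / 64" by simp
      \<comment> \<open>\<open>E\<close> compares a^2 with the noise. The choice of \<open>K\<close>
        keeps it below sqrt q / 32, so the loss 54 E^2 is linear in q and adds up to a multiple of
        log n over \<open>d\<close> coordinates.\<close>
      define E where "E = (a p)\<^sup>2 * D / (?s\<^sup>2 * ?t\<^sup>2)"
      have "E = K\<^sup>2 / d * (D\<^sup>2 / (4 * ?s\<^sup>2 * ?t\<^sup>2))"
        unfolding E_def a2 by (simp add: power2_eq_square[of D] mult_ac)
      \<comment> \<open>Here q \<le> 1, so the effect of unequal variances is at most a constant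
        factor.\<close>
      also have "\<dots> \<le> K\<^sup>2 / d * 2"
      proof (rule mult_left_mono)
        have "exp (q / 64) \<le> exp (1 / 2)" using q1 by simp
        also have "exp (1 / 2 :: real) \<le> 1 + 1 / 2 + (1 / 2)\<^sup>2" by (rule exp_bound) auto
        also have "\<dots> \<le> (2 :: real)" by (simp add: power2_eq_square)
        finally show "D\<^sup>2 / (4 * ?s\<^sup>2 * ?t\<^sup>2) \<le> 2" using Q by simp
      qed simp
      also have "\<dots> = sqrt q / 32"
      proof -
        have "sqrt (real d * L) / real d = sqrt q"
          using d L by (simp add: q_def real_sqrt_mult real_sqrt_divide field_simps)
        then show ?thesis unfolding K2 by (simp add: field_simps)
      qed
      finally have E: "E \<le> sqrt q / 32" .
      have E0: "E \<ge> 0" unfolding E_def using D by simp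
      have "sqrt q \<le> 1" using q1 by simp
      then have E30: "E \<le> 1/30" using E by linarith
      have "E\<^sup>2 \<le> (sqrt q / 32)\<^sup>2" using E E0 by (rule power_mono)
      then have E2: "E\<^sup>2 \<le> q / 1024" using q0 by (simp add: power_divide)
      have "exp (- (q / 16)) \<le> exp (- (q / 128)) * exp (- 54 * E\<^sup>2)"
        using q0 E2 by (simp flip: exp_add)
      also have "\<dots> \<le> Z * exp (- 54 * E\<^sup>2)"
        using Z by (intro mult_right_mono) auto
      finally have "ennreal (exp (- (q / 16))) \<le> ennreal (Z * exp (- 54 * E\<^sup>2))"
        by (rule ennreal_leI)
      also have "\<dots> \<le> (\<integral>\<^sup>+\<omega>. ennreal (sqrt (coord_mix p k False \<omega> * coord_mix p k True \<omega>)) \<partial>PiM (block p k) (\<lambda>_. lborel))"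
        using E30 unfolding Z_def E_def D_def by (rule affinity_coord_mix_signs[OF p T2])
      finally show ?thesis .
    qed
  qed
  have "1 - \<eta> \<le> exp (- ((exp (- (q / 16)) ^ d)\<^sup>2 / 4)) ^ (n div 2)"
  proof (rule bayes_success_le[OF est _ aff])
    fix W \<epsilon> assume W: "W \<subseteq> {..<n div 2}" and \<epsilon>: "\<epsilon> \<in> prior_signs"
    have "K \<le> rel_sep n d (theta \<epsilon>) \<sigma>"
      by (rule rel_sep_theta_ge[OF nd K0 _ \<epsilon>]) (auto simp: T_def a_def \<beta>_def R)
    then show "err_prob n d (theta \<epsilon>) \<sigma> (swap_pairs W) est \<le> \<eta>"
      by (intro err swap_pairs_permutes W)
  qed auto
  also have "(exp (- (q / 16)) ^ d)\<^sup>2 = exp (- (L / 8))"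
    using d by (simp add: q_def exp_of_nat_mult[symmetric] exp_double[symmetric])
  also have "exp (- (exp (- (L / 8)) / 4)) ^ (n div 2) = exp (- (real (n div 2) * (exp (- (L / 8)) / 4)))"
    by (simp add: exp_of_nat_mult[symmetric])
  also have "\<dots> \<le> exp (- (1 / 12))"
  proof -
    \<comment> \<open>The rounding in \<open>n div 2\<close> is paid by 1/3 in place of 1/2, and
      n^(-1/8) is weakened to 1 / n; with the 1/4 of the testing bound this gives 1/12.\<close>
    have "3 * (n div 2) \<ge> n" using nd by linarith
    then have "real n / 3 \<le> real (n div 2)" by linarith
    moreover have "1 / real n \<le> exp (- (L / 8))"
    proof -
      have "1 / real n = exp (- L)" using nd by (simp add: L_def exp_minus inverse_eq_divide)
      then show ?thesis using L by simp
    qed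
    ultimately have "real n / 3 * (1 / real n) \<le> real (n div 2) * exp (- (L / 8))"
      by (intro mult_mono) auto
    then show ?thesis using nd by simp
  qed
  also have "exp (- (1 / 12)) \<le> (12 / 13 :: real)"
  proof -
    have "1 + 1 / 12 \<le> exp (1 / 12 :: real)" by (rule exp_ge_add_one_self)
    then have "inverse (exp (1 / 12)) \<le> inverse (1 + 1 / 12 :: real)" by (intro le_imp_inverse_le) auto
    then show ?thesis by (simp add: exp_minus)
  qed
  finally show ?thesis by simp
qed

theorem theorem4:
  "\<exists>c C :: real. c > 0 \<and> C > 0 \<and>
    (\<forall>(n::nat) (d::nat) (\<sigma>::nat \<Rightarrow> real) (\<kappa>::real).
       n \<ge> 6 \<longrightarrow> d \<ge> 1 \<longrightarrow> (\<forall>i<n. \<sigma> i > 0) \<longrightarrow>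
       (Max {(\<sigma> i)\<^sup>2 | i. i < n}) / (Min {(\<sigma> i)\<^sup>2 | i. i < n}) - 1
          \<le> 1/4 * sqrt (ln (real n) / real d) \<longrightarrow>
       \<kappa> < 1/8 * max (sqrt (ln (real n))) ((c * real d * ln (real n)) powr (1/4)) \<longrightarrow>
       (INF est \<in> estimators n d.
          Max ((\<lambda>\<pi>. SUP \<theta> \<in> {\<theta>. rel_sep n d \<theta> \<sigma> \<ge> \<kappa>}. err_prob n d \<theta> \<sigma> \<pi> est)
               ` {\<pi>. \<pi> permutes {0..<n}})) > C)"
proof (rule exI[of _ 1], rule exI[of _ "1/14"], intro conjI allI impI)
  fix n d :: nat and \<sigma> :: "nat \<Rightarrow> real" and \<kappa> :: real
  assume n: "n \<ge> 6" and d: "d \<ge> 1" and "\<forall>i<n. \<sigma> i > 0"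
    and ratio: "(Max {(\<sigma> i)\<^sup>2 | i. i < n}) / (Min {(\<sigma> i)\<^sup>2 | i. i < n}) - 1 \<le> 1/4 * sqrt (ln (real n) / real d)"
    and \<kappa>: "\<kappa> < 1/8 * max (sqrt (ln (real n))) ((1 * real d * ln (real n)) powr (1/4))"
  then have \<sigma>: "\<And>i. i < n \<Longrightarrow> \<sigma> i > 0" by simp
  let ?risk = "\<lambda>est \<pi>. SUP \<theta> \<in> {\<theta>. rel_sep n d \<theta> \<sigma> \<ge> \<kappa>}. err_prob n d \<theta> \<sigma> \<pi> est"
  let ?max = "\<lambda>est. Max (?risk est ` {\<pi>. \<pi> permutes {0..<n}})"
  have "1/13 \<le> ?max est" if est: "est \<in> estimators n d" for est
  proof (rule max_error_ge[OF _ d \<sigma> ratio refl est])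
    fix \<pi> \<theta> assume \<pi>: "\<pi> permutes {0..<n}"
      and "1/8 * max (sqrt (ln (real n))) ((real d * ln (real n)) powr (1/4)) \<le> rel_sep n d \<theta> \<sigma>"
    then have "\<kappa> \<le> rel_sep n d \<theta> \<sigma>" using \<kappa> unfolding mult_1_left by linarith
    then have "err_prob n d \<theta> \<sigma> \<pi> est \<le> ?risk est \<pi>"
      using err_prob_le_1[OF \<sigma> \<pi>] by (intro cSUP_upper bdd_aboveI2) auto
    also have "\<dots> \<le> ?max est"
      using \<pi> by (intro Max_ge) (auto simp: finite_permutations)
    finally show "err_prob n d \<theta> \<sigma> \<pi> est \<le> ?max est" .
  qed (use n in auto)
  \<comment> \<open>A lower bound passes to a real infimum only over a nonempty set; a constant
    estimator provides a member.\<close>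
  moreover have "(\<lambda>_. id) \<in> estimators n d"
    by (simp add: estimators_def permutes_id)
  ultimately have "1/13 \<le> (INF est \<in> estimators n d. ?max est)"
    by (intro cINF_greatest) auto
  \<comment> \<open>The infimum inherits 1/13 only as a weak inequality; the slightly smaller 1/14
    makes it strict.\<close>
  then show "(INF est \<in> estimators n d. ?max est) > 1/14" by linarith
qed auto

end
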